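(* Let $K$ be a field and let $I$ be a nonzero proper graded ideal in $S=K[x_1,\ldots,x_n]$. Let $L$ be the lex ideal in $S$ with the same Hilbert function as $I$, let $u_1,\ldots,u_s$ be its minimal monomial generators, and let $m=\max\{\mathrm{m}(u_i)+\deg(u_i)-1\mid 1\leq i\leq s\}$. Write the Hilbert series of $I$ as $$H_I(t)=\frac{c_dt^d+\cdots+c_rt^r}{(1-t)^n}$$ with $c_i\in\mathbb{Z}$, $c_d\neq 0$, $c_r\neq 0$. Then $r\leq m$; set $Q(t):=c_dt^d+\cdots+c_mt^m$, where $c_{r+1}=\cdots=c_m=0$ if $r<m$. Consider the following procedure. Start with $q:=0$. For the current $q$, compute from $Q(t)$ and $q$ the integers $b_d,\ldots,b_m$ determined recursively by: $h_0:=Q$, and for $i=d,d+1,\ldots,m$, $b_i$ is the coefficient of $t^i$ in $h_{i-d}(t)$ and $h_{i-d+1}(t):=h_{i-d}(t)-b_it^i(1-t)^{\min\{q,\,m-i\}}$. If $b_d,\ldots,b_m\in\mathbb{Z}_{\geq 0}$, stop and output $n-q$; otherwise replace $q$ by $q+1$ and repeat. Then the procedure stops after finitely many steps (with some $q\leq m-d$), and its output equals $\mathrm{hdepth}(I)$.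
   Context: $S=K[x_1,\ldots,x_n]$ is $\mathbb{Z}$-graded with $\deg(x_i)=1$; $H_I(t)=\sum_k\dim_K(I_k)t^k$ is the Hilbert series of a graded ideal $I$. A Hilbert decomposition of a graded ideal $I$ is an isomorphism of graded $K$-vector spaces $\mathcal{H}: I\cong\bigoplus_{i=1}^e K[Z_i](-s_i)$ with $s_i\in\mathbb{Z}_{\geq 0}$ and $Z_i\subset\{x_1,\ldots,x_n\}$. Its Hilbert depth is $\mathrm{hdepth}(\mathcal{H})=\min_i|Z_i|$, and $\mathrm{hdepth}(I)$ is the maximum of $\mathrm{hdepth}(\mathcal{H})$ over all Hilbert decompositions $\mathcal{H}$ of $I$. A lex ideal is a monomial ideal $L$ such that whenever $u\in L$ is a monomial and $v$ is a monomial of the same degree with $v>_{\mathrm{lex}}u$ (with $x_1>x_2>\cdots>x_n$), then $v\in L$. By Macaulay's theorem, for every graded ideal there is a unique lex ideal in $S$ with the same Hilbert function. For a monomial $u\ne 1$, $\mathrm{m}(u)$ denotes the largest index $i$ such that $x_i$ divides $u$. *)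

theory Defs
  imports
    "HOL-Library.Poly_Mapping"
    "HOL-Library.While_Combinator"
    "HOL-Computational_Algebra.Polynomial_FPS"
begin

type_synonym monom = "nat \<Rightarrow>\<^sub>0 nat"
type_synonym 'k mpol = "monom \<Rightarrow>\<^sub>0 'k"

text \<open>The variables of \<open>K[x\<^sub>1, \<dots>, x\<^sub>n]\<close> are indexed by \<open>{1..n}\<close>; the type \<open>'k mpol\<close> itself has
  countably many variables, so the polynomial ring is a carrier set.\<close>

definition poly_ring_in :: "nat set \<Rightarrow> 'k::field mpol set" where
  "poly_ring_in Z = {p. \<forall>u\<in>Poly_Mapping.keys p. Poly_Mapping.keys u \<subseteq> Z}"

abbreviation poly_ring :: "nat \<Rightarrow> 'k::field mpol set" where
  "poly_ring n \<equiv> poly_ring_in {1..n}"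

abbreviation monomials :: "nat \<Rightarrow> monom set" where
  "monomials n \<equiv> {u. Poly_Mapping.keys u \<subseteq> {1..n}}"

definition mono_poly :: "monom \<Rightarrow> 'k::field mpol" where
  "mono_poly u = Poly_Mapping.single u 1"

definition mdeg :: "monom \<Rightarrow> nat" where
  "mdeg u = (\<Sum>i\<in>Poly_Mapping.keys u. Poly_Mapping.lookup u i)"

definition max_var :: "monom \<Rightarrow> nat" where
  "max_var u = Max (Poly_Mapping.keys u)"

definition scale :: "'k::field \<Rightarrow> 'k mpol \<Rightarrow> 'k mpol" where
  "scale a p = Poly_Mapping.single 0 a * p"

global_interpretation mpol: vector_space "scale :: 'k::field \<Rightarrow> 'k mpol \<Rightarrow> 'k mpol"
  by unfold_locales
    (simp_all add: scale_def distrib_left distrib_right single_add mult_single mult.assoc [symmetric])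

definition homogeneous :: "nat \<Rightarrow> 'k::field mpol \<Rightarrow> bool" where
  "homogeneous k p \<longleftrightarrow> (\<forall>u\<in>Poly_Mapping.keys p. mdeg u = k)"

definition hom_component :: "nat \<Rightarrow> 'k::field mpol \<Rightarrow> 'k mpol" where
  "hom_component k p =
    (\<Sum>u\<in>{u \<in> Poly_Mapping.keys p. mdeg u = k}. Poly_Mapping.single u (Poly_Mapping.lookup p u))"

definition is_ideal :: "nat \<Rightarrow> 'k::field mpol set \<Rightarrow> bool" where
  "is_ideal n I \<longleftrightarrow> I \<subseteq> poly_ring n \<and> 0 \<in> I \<and> (\<forall>p\<in>I. \<forall>q\<in>I. p + q \<in> I) \<and>
    (\<forall>f\<in>poly_ring n. \<forall>p\<in>I. f * p \<in> I)"

definition graded_ideal :: "nat \<Rightarrow> 'k::field mpol set \<Rightarrow> bool" where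
  "graded_ideal n I \<longleftrightarrow> is_ideal n I \<and> (\<forall>p\<in>I. \<forall>k. hom_component k p \<in> I)"

definition graded_part :: "'k::field mpol set \<Rightarrow> nat \<Rightarrow> 'k mpol set" where
  "graded_part I k = {p \<in> I. homogeneous k p}"

definition hilbert_function :: "'k::field mpol set \<Rightarrow> nat \<Rightarrow> nat" where
  "hilbert_function I k = mpol.dim (graded_part I k)"

definition hilbert_series :: "'k::field mpol set \<Rightarrow> int fps" where
  "hilbert_series I = Abs_fps (\<lambda>k. int (hilbert_function I k))"

definition generated_by_monomials :: "nat \<Rightarrow> 'k::field mpol set \<Rightarrow> monom set \<Rightarrow> bool" where
  "generated_by_monomials n L G \<longleftrightarrow> G \<subseteq> monomials n \<and> L = is_ideal n hull (mono_poly ` G)"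

definition monomial_ideal :: "nat \<Rightarrow> 'k::field mpol set \<Rightarrow> bool" where
  "monomial_ideal n L \<longleftrightarrow> (\<exists>G. generated_by_monomials n L G)"

definition minimal_monomial_generators :: "nat \<Rightarrow> 'k::field mpol set \<Rightarrow> monom set \<Rightarrow> bool" where
  "minimal_monomial_generators n L G \<longleftrightarrow>
    generated_by_monomials n L G \<and> (\<forall>G'. G' \<subset> G \<longrightarrow> \<not> generated_by_monomials n L G')"

text \<open>The order \<open><\<close> of \<^typ>\<open>nat \<Rightarrow>\<^sub>0 nat\<close> compares exponents at the smallest index where they
  differ, so it is the pure lexicographic order with \<open>x\<^sub>1 > x\<^sub>2 > \<dots>\<close>.\<close>

definition lex_ideal :: "nat \<Rightarrow> 'k::field mpol set \<Rightarrow> bool" where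
  "lex_ideal n L \<longleftrightarrow> monomial_ideal n L \<and>
    (\<forall>u\<in>monomials n. \<forall>v\<in>monomials n.
      mono_poly u \<in> L \<and> mdeg v = mdeg u \<and> u < v \<longrightarrow> mono_poly v \<in> L)"

text \<open>A list \<open>[(Z\<^sub>1, s\<^sub>1), \<dots>, (Z\<^sub>e, s\<^sub>e)]\<close> encodes the module \<open>\<Oplus>\<^sub>i K[Z\<^sub>i](-s\<^sub>i)\<close>, whose elements are
  families of polynomials extended by \<open>0\<close> beyond the index range. The degree \<open>k\<close> part of
  \<open>K[Z](-s)\<close> is \<open>K[Z]\<^bsub>k-s\<^esub>\<close>, which is zero for \<open>k < s\<close>.\<close>

definition dsum :: "(nat set \<times> nat) list \<Rightarrow> (nat \<Rightarrow> 'k::field mpol) set" where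
  "dsum D = {f. (\<forall>i<length D. f i \<in> poly_ring_in (fst (D ! i))) \<and> (\<forall>i\<ge>length D. f i = 0)}"

definition dsum_part :: "(nat set \<times> nat) list \<Rightarrow> nat \<Rightarrow> (nat \<Rightarrow> 'k::field mpol) set" where
  "dsum_part D k =
    {f \<in> dsum D. \<forall>i<length D. \<forall>u\<in>Poly_Mapping.keys (f i). mdeg u + snd (D ! i) = k}"

definition hilbert_decomposition ::
  "nat \<Rightarrow> 'k::field mpol set \<Rightarrow> (nat set \<times> nat) list \<Rightarrow> ('k mpol \<Rightarrow> nat \<Rightarrow> 'k mpol) \<Rightarrow> bool" where
  "hilbert_decomposition n I D \<phi> \<longleftrightarrow>
    (\<forall>(Z, s)\<in>set D. Z \<subseteq> {1..n}) \<and>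
    bij_betw \<phi> I (dsum D) \<and>
    (\<forall>p\<in>I. \<forall>q\<in>I. \<forall>i. \<phi> (p + q) i = \<phi> p i + \<phi> q i) \<and>
    (\<forall>a. \<forall>p\<in>I. \<forall>i. \<phi> (scale a p) i = scale a (\<phi> p i)) \<and>
    (\<forall>k. \<phi> ` graded_part I k = dsum_part D k)"

definition decomposition_depth :: "(nat set \<times> nat) list \<Rightarrow> nat" where
  "decomposition_depth D = Min ((\<lambda>(Z, s). card Z) ` set D)"

definition hdepth :: "nat \<Rightarrow> 'k::field mpol set \<Rightarrow> nat" where
  "hdepth n I = Max {decomposition_depth D | D \<phi>. hilbert_decomposition n I D \<phi>}"

primrec residual :: "int poly \<Rightarrow> nat \<Rightarrow> nat \<Rightarrow> nat \<Rightarrow> nat \<Rightarrow> int poly" where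
  "residual Q d m q 0 = Q"
| "residual Q d m q (Suc j) = residual Q d m q j -
    monom (coeff (residual Q d m q j) (d + j)) (d + j) * [:1, -1:] ^ min q (m - (d + j))"

definition b_coeff :: "int poly \<Rightarrow> nat \<Rightarrow> nat \<Rightarrow> nat \<Rightarrow> nat \<Rightarrow> int" where
  "b_coeff Q d m q i = coeff (residual Q d m q (i - d)) i"

text \<open>\<^const>\<open>while_option\<close> yields \<^const>\<open>None\<close> exactly if the loop does not stop.\<close>

definition final_q :: "int poly \<Rightarrow> nat \<Rightarrow> nat \<Rightarrow> nat option" where
  "final_q Q d m = while_option (\<lambda>q. \<not> (\<forall>i\<in>{d..m}. b_coeff Q d m q i \<ge> 0)) Suc 0"

definition hdepth_procedure :: "nat \<Rightarrow> int poly \<Rightarrow> nat \<Rightarrow> nat \<Rightarrow> int option" where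
  "hdepth_procedure n Q d m = map_option (\<lambda>q. int n - int q) (final_q Q d m)"

end

theory Submission
  imports Defs
begin

text \<open>A Hilbert decomposition with summands \<open>K[Z\<^sub>i](-s\<^sub>i)\<close> exists if and only if
  \<open>H\<^sub>I(t) = \<Sum>\<^sub>i t\<^bsup>s\<^sub>i\<^esup> / (1 - t)\<^bsup>|Z\<^sub>i|\<^esup>\<close>, so only \<open>Q(t) = (1 - t)\<^sup>n H\<^sub>I(t)\<close> matters. The number \<open>b\<^sub>i\<close> is the
  coefficient of \<open>t\<^sup>i\<close> in \<open>Q(t) / (1 - t)\<^bsup>min{q, m + 1 - i}\<^esup>\<close>. The Eliahou-Kervaire decomposition of the
  lex ideal gives \<open>Q(t) = \<Sum>\<^sub>u t\<^bsup>deg u\<^esup> (1 - t)\<^bsup>m(u) - 1\<^esup>\<close> with \<open>deg u + m(u) - 1 \<le> m\<close>. Dividing by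
  \<open>(1 - t)\<^bsup>m + 1 - i\<^esup>\<close>, the summands with \<open>m(u) - 1 \<le> m + 1 - i\<close> have nonnegative coefficients and the
  others become polynomials of degree less than \<open>i\<close>; hence \<open>b\<^sub>i \<ge> 0\<close> whenever \<open>i > m - q\<close>, whatever \<open>q\<close> is.
  For \<open>i \<le> m - q\<close> the condition \<open>b\<^sub>i \<ge> 0\<close> concerns \<open>Q(t) / (1 - t)\<^sup>q = (1 - t)\<^bsup>n - q\<^esup> H\<^sub>I(t)\<close>, which has
  nonnegative coefficients if \<open>I\<close> has a decomposition of depth at least \<open>n - q\<close>. Conversely,
  nonnegative \<open>b\<^sub>i\<close> are the multiplicities of such a decomposition, as
  \<open>Q(t) = \<Sum>\<^sub>i b\<^sub>i t\<^sup>i (1 - t)\<^bsup>min{q, m - i}\<^esup>\<close>.\<close>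

section \<open>Monomials of a given degree\<close>

lemma mdeg_eq_sum:
  assumes "finite A" "Poly_Mapping.keys u \<subseteq> A"
  shows "mdeg u = (\<Sum>i\<in>A. Poly_Mapping.lookup u i)"
  unfolding mdeg_def using assms by (intro sum.mono_neutral_left) (auto simp: in_keys_iff)

lemma keys_add_nat:
  "Poly_Mapping.keys (u + v) = Poly_Mapping.keys u \<union> Poly_Mapping.keys (v :: monom)"
  by (auto simp: in_keys_iff lookup_add)

lemma mdeg_add: "mdeg (u + v) = mdeg u + mdeg v"
  by (subst (1 2 3) mdeg_eq_sum[where A = "Poly_Mapping.keys u \<union> Poly_Mapping.keys v"])
    (auto simp: keys_add_nat lookup_add sum.distrib)

lemma mdeg_zero [simp]: "mdeg 0 = 0"
  by (simp add: mdeg_def)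

lemma mdeg_single [simp]: "mdeg (Poly_Mapping.single i e) = e"
  by (simp add: mdeg_def)

lemma mdeg_eq_0_iff [simp]: "mdeg u = 0 \<longleftrightarrow> u = 0"
  by (auto simp: mdeg_def in_keys_iff intro!: poly_mapping_eqI)

lemma monom_diff_add:
  assumes "\<And>i. Poly_Mapping.lookup u i \<le> Poly_Mapping.lookup w i"
  shows "u + (w - u) = (w :: monom)"
  using assms by (intro poly_mapping_eqI) (simp add: lookup_add lookup_minus)

lemma single_diff_add:
  assumes "i \<in> Poly_Mapping.keys w"
  shows "w - Poly_Mapping.single i 1 + Poly_Mapping.single i 1 = (w :: monom)"
  using assms by (intro poly_mapping_eqI) (auto simp: lookup_add lookup_minus lookup_single when_def in_keys_iff)

definition monomials_of_degree :: "nat set \<Rightarrow> nat \<Rightarrow> monom set" where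
  "monomials_of_degree Z k = {u. Poly_Mapping.keys u \<subseteq> Z \<and> mdeg u = k}"

lemma monomials_of_degree_0 [simp]: "monomials_of_degree Z 0 = {0}"
  by (auto simp: monomials_of_degree_def)

lemma monomials_of_degree_empty: "monomials_of_degree {} k = (if k = 0 then {0} else {})"
  by (auto simp: monomials_of_degree_def)

text \<open>Sort the monomials by whether \<open>z\<close> divides them; from those that it divides,
  one factor \<open>z\<close> can be removed.\<close>

lemma monomials_of_degree_insert:
  assumes "z \<notin> Z"
  shows "monomials_of_degree (insert z Z) (Suc k) = monomials_of_degree Z (Suc k) \<union>
    (\<lambda>u. u + Poly_Mapping.single z 1) ` monomials_of_degree (insert z Z) k" (is "?A = ?B \<union> ?f ` ?C")
proof (intro equalityI subsetI)
  fix u assume u: "u \<in> ?A"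
  show "u \<in> ?B \<union> ?f ` ?C"
  proof (cases "z \<in> Poly_Mapping.keys u")
    case True
    define v where "v = u - Poly_Mapping.single z 1"
    have uv: "u = v + Poly_Mapping.single z 1"
      unfolding v_def using single_diff_add[OF True] by simp
    have "v \<in> ?C"
      using u unfolding uv monomials_of_degree_def by (auto simp: mdeg_add keys_add_nat)
    then show ?thesis using uv by blast
  next
    case False
    then show ?thesis using u by (auto simp: monomials_of_degree_def)
  qed
qed (auto simp: monomials_of_degree_def mdeg_add keys_add_nat)

lemma finite_monomials_of_degree:
  assumes "finite Z"
  shows "finite (monomials_of_degree Z k)"
  using assms
proof (induction Z arbitrary: k rule: finite_induct)
  case (insert z Z)
  show ?case
    by (induction k) (simp_all add: insert monomials_of_degree_insert)
qed (simp add: monomials_of_degree_empty)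

lemma card_monomials_of_degree_insert:
  assumes "finite Z" "z \<notin> Z"
  shows "card (monomials_of_degree (insert z Z) (Suc k)) =
    card (monomials_of_degree Z (Suc k)) + card (monomials_of_degree (insert z Z) k)"
proof -
  have "monomials_of_degree Z (Suc k) \<inter>
      (\<lambda>u. u + Poly_Mapping.single z 1) ` monomials_of_degree (insert z Z) k = {}"
    using assms(2) by (auto simp: monomials_of_degree_def keys_add_nat)
  moreover have "inj_on (\<lambda>u. u + Poly_Mapping.single z 1) (monomials_of_degree (insert z Z) k)"
    by (auto intro: inj_onI)
  ultimately show ?thesis
    using assms by (simp add: monomials_of_degree_insert card_Un_disjoint card_image
        finite_monomials_of_degree)
qed

text \<open>The inverse of \<open>1 - fps_X\<close> over the integers. A quotient by a power of 1 -
  t is always written as a product with a power of \<open>geom\<close>.\<close>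

definition geom :: "int fps" where
  "geom = Abs_fps (\<lambda>_. 1)"

lemma one_minus_X_mult_geom [simp]: "(1 - fps_X) * geom = 1"
proof (rule fps_ext)
  fix k
  show "fps_nth ((1 - fps_X) * geom) k = fps_nth 1 k"
    by (cases k) (simp_all add: geom_def left_diff_distrib)
qed

lemma one_minus_X_power_mult_geom_power [simp]: "(1 - fps_X) ^ k * geom ^ k = 1"
  by (simp flip: power_mult_distrib)

lemma geom_power_cancel:
  assumes "j \<le> k"
  shows "(1 - fps_X) ^ j * geom ^ k = geom ^ (k - j)"
proof -
  have "geom ^ k = geom ^ j * geom ^ (k - j)"
    using assms by (simp flip: power_add)
  then show ?thesis by (simp flip: mult.assoc)
qed

lemma one_minus_X_power_cancel:
  assumes "k \<le> j"
  shows "(1 - fps_X) ^ j * geom ^ k = (1 - fps_X) ^ (j - k)"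
proof -
  have "(1 - fps_X :: int fps) ^ j = (1 - fps_X) ^ (j - k) * (1 - fps_X) ^ k"
    using assms by (simp flip: power_add)
  then show ?thesis by (simp only: mult.assoc one_minus_X_power_mult_geom_power mult_1_right)
qed

definition nonneg_fps :: "int fps \<Rightarrow> bool" where
  "nonneg_fps f \<longleftrightarrow> (\<forall>i. fps_nth f i \<ge> 0)"

lemma nonneg_fps_mult: "nonneg_fps f \<Longrightarrow> nonneg_fps g \<Longrightarrow> nonneg_fps (f * g)"
  by (auto simp: nonneg_fps_def fps_mult_nth intro!: sum_nonneg)

lemma nonneg_fps_sum: "(\<And>x. x \<in> A \<Longrightarrow> nonneg_fps (f x)) \<Longrightarrow> nonneg_fps (sum f A)"
  by (auto simp: nonneg_fps_def fps_sum_nth intro!: sum_nonneg)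

lemma nonneg_fps_geom_power: "nonneg_fps (geom ^ k)"
proof (induction k)
  case (Suc k)
  moreover have "nonneg_fps geom" by (simp add: nonneg_fps_def geom_def)
  ultimately show ?case by (simp add: nonneg_fps_mult)
qed (simp add: nonneg_fps_def)

lemma nonneg_fps_X_power: "nonneg_fps (fps_X ^ k)"
  by (simp add: nonneg_fps_def)

text \<open>This is the Hilbert series of K[Z]. By the recursion for \<open>insert z Z\<close>,
  adjoining a variable multiplies it by 1/(1 - t).\<close>

lemma card_monomials_of_degree:
  assumes "finite Z"
  shows "Abs_fps (\<lambda>k. int (card (monomials_of_degree Z k))) = geom ^ card Z"
  using assms
proof (induction Z rule: finite_induct)
  case empty
  show ?case by (rule fps_ext) (simp add: monomials_of_degree_empty)
next
  case (insert z Z)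
  let ?N = "\<lambda>Z. Abs_fps (\<lambda>k. int (card (monomials_of_degree Z k)))"
  have "(1 - fps_X) * ?N (insert z Z) = ?N Z"
  proof (rule fps_ext)
    fix k
    show "fps_nth ((1 - fps_X) * ?N (insert z Z)) k = fps_nth (?N Z) k"
      using insert(1,2) by (cases k) (simp_all add: left_diff_distrib card_monomials_of_degree_insert)
  qed
  then have "geom * ((1 - fps_X) * ?N (insert z Z)) = geom * ?N Z" by simp
  moreover have "geom * ((1 - fps_X) * ?N (insert z Z)) = ((1 - fps_X) * geom) * ?N (insert z Z)"
    by (simp only: mult_ac)
  ultimately show ?case
    using insert by simp
qed

text \<open>The Hilbert series of K[Z](-s). The condition \<open>mdeg u + s = k\<close> makes the
  part of degree k < s empty, where \<open>k - s\<close> would truncate to 0.\<close>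

lemma card_monomials_of_degree_shift:
  assumes "finite Z"
  shows "int (card {u. Poly_Mapping.keys u \<subseteq> Z \<and> mdeg u + s = k}) = fps_nth (fps_X ^ s * geom ^ card Z) k"
proof -
  have "{u. Poly_Mapping.keys u \<subseteq> Z \<and> mdeg u + s = k} =
      (if k < s then {} else monomials_of_degree Z (k - s))"
    by (auto simp: monomials_of_degree_def)
  then show ?thesis
    by (simp add: fps_X_power_mult_nth flip: card_monomials_of_degree[OF assms])
qed

lemma finite_monomials_of_degree_shift:
  assumes "finite Z"
  shows "finite {u. Poly_Mapping.keys u \<subseteq> Z \<and> mdeg u + s = k}"
  by (rule finite_subset[OF _ finite_monomials_of_degree[OF assms, of "k - s"]])
    (auto simp: monomials_of_degree_def)

section \<open>The numbers computed by the procedure\<close>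

lemma fps_nth_one_minus_X_power_eq_0:
  assumes "k < i"
  shows "fps_nth ((1 - fps_X :: int fps) ^ k) i = 0"
  using assms
proof (induction k arbitrary: i)
  case (Suc k)
  then show ?case by (cases i) (simp_all add: left_diff_distrib)
qed simp

lemma fps_mult_nth_lowest:
  fixes f g :: "'a::semiring_0 fps"
  assumes "\<And>l. l < i \<Longrightarrow> fps_nth f l = 0"
  shows "fps_nth (f * g) i = fps_nth f i * fps_nth g 0"
proof -
  have "fps_nth (f * g) i = (\<Sum>l = 0..i. fps_nth f l * fps_nth g (i - l))"
    by (rule fps_mult_nth)
  also have "\<dots> = (\<Sum>l \<in> {i}. fps_nth f l * fps_nth g (i - l))"
    using assms by (intro sum.mono_neutral_right) (auto simp: le_less)
  finally show ?thesis by simp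
qed

lemma fps_nth_geom_power_0 [simp]: "fps_nth (geom ^ k) 0 = 1"
  by (simp add: geom_def fps_power_zeroth)

lemma fps_of_poly_one_minus_X_power: "fps_of_poly ([:1, -1:] ^ k) = (1 - fps_X :: int fps) ^ k"
  by (simp add: fps_of_poly_power fps_of_poly_linear)

text \<open>Step j changes only coefficients from d + j on and cancels the one at d + j, because
  powers of 1 - t have constant term 1.\<close>

lemma coeff_residual_below:
  assumes "\<And>i. i < d \<Longrightarrow> coeff Q i = 0" and "i < d + j"
  shows "coeff (residual Q d m q j) i = 0"
  using assms(2)
proof (induction j)
  case 0
  then show ?case using assms(1) by simp
next
  case (Suc j)
  then show ?case
    by (cases "i = d + j") (auto simp: coeff_monom_mult coeff_0_power)
qed

text \<open>The cap m - (d + j) on the exponent keeps every subtracted term in degree at most m. The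
  bound on \<open>j\<close> makes this cap a true difference at each step.\<close>

lemma coeff_residual_above:
  assumes "\<And>i. i > m \<Longrightarrow> coeff Q i = 0" and "i > m" and "d + j \<le> Suc m"
  shows "coeff (residual Q d m q j) i = 0"
  using assms(3)
proof (induction j)
  case 0
  then show ?case using assms by simp
next
  case (Suc j)
  have "fps_nth ((1 - fps_X :: int fps) ^ min q (m - (d + j))) (i - (d + j)) = 0"
    using Suc.prems assms(2) by (intro fps_nth_one_minus_X_power_eq_0) auto
  then have "coeff ([:1, -1:] ^ min q (m - (d + j)) :: int poly) (i - (d + j)) = 0"
    by (simp flip: fps_of_poly_one_minus_X_power)
  then show ?case using Suc assms(2) by (simp add: coeff_monom_mult)
qed

lemma fps_of_poly_eq_residual:
  "fps_of_poly Q = (\<Sum>j<J. fps_const (b_coeff Q d m q (d + j)) *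
      (fps_X ^ (d + j) * (1 - fps_X) ^ min q (m - (d + j)))) + fps_of_poly (residual Q d m q J)"
proof (induction J)
  case (Suc J)
  then show ?case
    by (simp add: b_coeff_def fps_of_poly_diff fps_of_poly_mult fps_of_poly_monom
        fps_of_poly_one_minus_X_power mult.assoc)
qed simp

text \<open>After m + 1 - d steps the residual has no coefficient up to m and none above m, so the
  telescoped recursion is an exact expansion of \<open>Q\<close>.\<close>

lemma fps_of_poly_eq_b_coeff_sum:
  assumes "\<And>i. i < d \<Longrightarrow> coeff Q i = 0" and "\<And>i. i > m \<Longrightarrow> coeff Q i = 0" and "d \<le> m"
  shows "fps_of_poly Q = (\<Sum>i = d..m. fps_const (b_coeff Q d m q i) *
      (fps_X ^ i * (1 - fps_X) ^ min q (m - i)))"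
proof -
  have "residual Q d m q (Suc m - d) = 0"
  proof (rule poly_eqI)
    fix i
    show "coeff (residual Q d m q (Suc m - d)) i = coeff 0 i"
      using coeff_residual_below[of d Q i "Suc m - d" m q] coeff_residual_above[of m Q i d "Suc m - d" q]
        assms by (cases "i > m") auto
  qed
  then have "fps_of_poly Q = (\<Sum>j<Suc m - d. fps_const (b_coeff Q d m q (d + j)) *
      (fps_X ^ (d + j) * (1 - fps_X) ^ min q (m - (d + j))))"
    using fps_of_poly_eq_residual[of Q d m q "Suc m - d"] by simp
  also have "\<dots> = (\<Sum>i = d..m. fps_const (b_coeff Q d m q i) *
      (fps_X ^ i * (1 - fps_X) ^ min q (m - i)))"
    using assms(3) by (intro sum.reindex_bij_witness[where i = "\<lambda>i. i - d" and j = "\<lambda>j. d + j"]) auto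
  finally show ?thesis .
qed

text \<open>After division by \<open>(1 - t) ^ min q (m + 1 - i)\<close>, the term of index \<open>j < i\<close> in the expansion of
  \<open>Q\<close> becomes a polynomial of degree less than \<open>i\<close>.\<close>

lemma b_coeff_eq_fps_nth:
  assumes "\<And>i. i < d \<Longrightarrow> coeff Q i = 0" and "d \<le> i" "i \<le> m"
  shows "b_coeff Q d m q i = fps_nth (fps_of_poly Q * geom ^ min q (Suc m - i)) i"
proof -
  let ?e = "min q (Suc m - i)" and ?R = "fps_of_poly (residual Q d m q (i - d))"
  have vanish: "fps_nth (fps_const c * (fps_X ^ (d + j) * (1 - fps_X) ^ min q (m - (d + j))) * geom ^ ?e) i = 0"
    if "j < i - d" for j c
  proof -
    have "(1 - fps_X) ^ min q (m - (d + j)) * geom ^ ?e = (1 - fps_X) ^ (min q (m - (d + j)) - ?e)"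
      using that assms by (intro one_minus_X_power_cancel) auto
    \<comment> \<open>The exponent is at most (m - (d + j)) - (m + 1 - i) = i - (d + j) - 1, below
      the index read off. With m - i in place of m + 1 - i the bound would only be i - (d +
      j).\<close>
    moreover have "fps_nth ((1 - fps_X :: int fps) ^ (min q (m - (d + j)) - ?e)) (i - (d + j)) = 0"
      using that assms by (intro fps_nth_one_minus_X_power_eq_0) auto
    ultimately show ?thesis
      by (simp add: mult.assoc fps_X_power_mult_nth)
  qed
  have "fps_nth (fps_of_poly Q * geom ^ ?e) i = fps_nth (?R * geom ^ ?e) i"
    by (subst fps_of_poly_eq_residual[of Q d m q "i - d"])
      (simp add: distrib_right sum_distrib_right fps_sum_nth vanish)
  also have "\<dots> = fps_nth ?R i"
    using coeff_residual_below[of d Q _ "i - d" m q] assms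
    by (subst fps_mult_nth_lowest) auto
  finally show ?thesis by (simp add: b_coeff_def)
qed

lemma fps_nth_sum_geom_power_nonneg:
  assumes "\<And>x. x \<in> G \<Longrightarrow> a x + k x \<le> m" and "i \<le> m"
  shows "fps_nth ((\<Sum>x\<in>G. fps_X ^ a x * (1 - fps_X) ^ k x) * geom ^ (Suc m - i)) i \<ge> 0"
proof -
  have "fps_nth (fps_X ^ a x * (1 - fps_X) ^ k x * geom ^ (Suc m - i)) i \<ge> 0" if "x \<in> G" for x
  proof (cases "k x \<le> Suc m - i")
    case True
    then have eq: "fps_X ^ a x * (1 - fps_X) ^ k x * geom ^ (Suc m - i) =
        fps_X ^ a x * geom ^ (Suc m - i - k x)"
      by (simp add: mult.assoc geom_power_cancel)
    show ?thesis
      unfolding eq using nonneg_fps_mult[OF nonneg_fps_X_power nonneg_fps_geom_power]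
      unfolding nonneg_fps_def by blast
  next
    case False
    then have eq: "fps_X ^ a x * (1 - fps_X) ^ k x * geom ^ (Suc m - i) =
        fps_X ^ a x * (1 - fps_X) ^ (k x - (Suc m - i))"
      by (simp add: mult.assoc one_minus_X_power_cancel)
    \<comment> \<open>The degree is a x + k x - (m + 1 - i), hence less than i.\<close>
    have "fps_nth (fps_X ^ a x * (1 - fps_X) ^ k x * geom ^ (Suc m - i)) i = 0"
      unfolding eq fps_X_power_mult_nth
      using assms(1)[OF that] assms(2) False by (auto intro!: fps_nth_one_minus_X_power_eq_0)
    then show ?thesis by simp
  qed
  then show ?thesis
    by (simp add: sum_distrib_right fps_sum_nth sum_nonneg)
qed

text \<open>For i + q \<le> m the exponent \<open>min q (Suc m - i)\<close> is q, and the last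
  hypothesis decides. For larger i it is \<open>Suc m - i\<close>, and the shape of the numerator
  alone gives the sign.\<close>

lemma b_coeff_nonneg:
  assumes "fps_of_poly Q = (\<Sum>x\<in>G. fps_X ^ a x * (1 - fps_X) ^ k x)"
    and "\<And>x. x \<in> G \<Longrightarrow> a x + k x \<le> m"
    and "\<And>i. i < d \<Longrightarrow> coeff Q i = 0" and "d \<le> i" "i \<le> m"
    and "i + q \<le> m \<Longrightarrow> fps_nth (fps_of_poly Q * geom ^ q) i \<ge> 0"
  shows "b_coeff Q d m q i \<ge> 0"
proof (cases "i + q \<le> m")
  case True
  then have "min q (Suc m - i) = q" by auto
  then show ?thesis
    using assms(6)[OF True] b_coeff_eq_fps_nth[of d Q i m q, OF assms(3-5)] by simp
next
  case False
  then have "min q (Suc m - i) = Suc m - i" by auto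
  then show ?thesis
    using fps_nth_sum_geom_power_nonneg[of G a k m i, OF assms(2,5)]
      b_coeff_eq_fps_nth[of d Q i m q, OF assms(3-5)] assms(1) by simp
qed

section \<open>Hilbert decompositions and Hilbert series\<close>

lemma lookup_scale: "Poly_Mapping.lookup (scale a p) u = a * Poly_Mapping.lookup p u"
  by (simp add: scale_def map.rep_eq when_def flip: mult_map_scale_conv_mult)

lemma poly_mapping_sum_mono_poly:
  "p = (\<Sum>u\<in>Poly_Mapping.keys p. scale (Poly_Mapping.lookup p u) (mono_poly u))"
  by (rule poly_mapping_eqI)
    (simp add: lookup_sum lookup_scale mono_poly_def lookup_single when_def if_distrib in_keys_iff
      cong: if_cong)

lemma lookup_hom_component:
  "Poly_Mapping.lookup (hom_component k p) u = (if mdeg u = k then Poly_Mapping.lookup p u else 0)"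
  by (auto simp: hom_component_def lookup_sum lookup_single when_def in_keys_iff)

lemma hom_component_add: "hom_component k (p + q) = hom_component k p + hom_component k q"
  by (rule poly_mapping_eqI) (simp add: lookup_hom_component lookup_add)

lemma hom_component_scale: "hom_component k (scale a p) = scale a (hom_component k p)"
  by (rule poly_mapping_eqI) (simp add: lookup_hom_component lookup_scale)

lemma hom_component_0 [simp]: "hom_component k 0 = 0"
  by (rule poly_mapping_eqI) (simp add: lookup_hom_component)

lemma homogeneous_hom_component: "homogeneous k (hom_component k p)"
  by (auto simp: homogeneous_def in_keys_iff lookup_hom_component split: if_splits)

lemma hom_component_homogeneous:
  assumes "homogeneous j p"
  shows "hom_component k p = (if j = k then p else 0)"
  using assms by (intro poly_mapping_eqI) (auto simp: lookup_hom_component homogeneous_def in_keys_iff)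

lemma homogeneousI:
  assumes "\<And>j. j \<noteq> k \<Longrightarrow> hom_component j p = 0"
  shows "homogeneous k p"
proof -
  have "mdeg u = k" if "u \<in> Poly_Mapping.keys p" for u
    using assms[of "mdeg u"] lookup_hom_component[of "mdeg u" p u] that
    by (cases "mdeg u = k") (simp_all add: in_keys_iff)
  then show ?thesis by (simp add: homogeneous_def)
qed

lemma eq_0_if_hom_components_eq_0:
  assumes "\<And>k. hom_component k p = 0"
  shows "p = 0"
  using assms lookup_hom_component[of _ p]
  by (intro poly_mapping_eqI) (metis lookup_zero)

lemma ideal_subspace:
  assumes "is_ideal n (I :: 'k::field mpol set)"
  shows "mpol.subspace I"
proof (rule mpol.subspaceI)
  fix a :: 'k and p assume "p \<in> I"
  moreover have "Poly_Mapping.single 0 a \<in> poly_ring n"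
    by (auto simp: poly_ring_in_def)
  ultimately show "scale a p \<in> I"
    using assms by (auto simp: is_ideal_def scale_def)
qed (use assms in \<open>auto simp: is_ideal_def\<close>)

lemma graded_part_subspace:
  assumes "is_ideal n (I :: 'k::field mpol set)"
  shows "mpol.subspace (graded_part I k)"
proof (rule mpol.subspaceI)
  fix p q assume "p \<in> graded_part I k" "q \<in> graded_part I k"
  then show "p + q \<in> graded_part I k"
    using mpol.subspace_add[OF ideal_subspace[OF assms]] keys_add[of p q]
    by (auto simp: graded_part_def homogeneous_def)
next
  fix a and p assume "p \<in> graded_part I k"
  then show "scale a p \<in> graded_part I k"
    using mpol.subspace_scale[OF ideal_subspace[OF assms]]
    by (auto simp: graded_part_def homogeneous_def in_keys_iff lookup_scale)
qed (use mpol.subspace_0[OF ideal_subspace[OF assms]] in \<open>auto simp: graded_part_def homogeneous_def\<close>)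

text \<open>Coordinates that separate the points of \<open>V\<close> and have a dual family in
  \<open>V\<close> yield a basis. Linearity is asked only on \<open>V\<close>, since the isomorphism
  of a Hilbert decomposition is linear only on the ideal.\<close>

lemma dim_eq_card_coordinates:
  fixes coord :: "'k::field mpol \<Rightarrow> 'a \<Rightarrow> 'k"
  assumes "finite A" and V: "mpol.subspace V"
    and add: "\<And>p q a. p \<in> V \<Longrightarrow> q \<in> V \<Longrightarrow> coord (p + q) a = coord p a + coord q a"
    and scale: "\<And>c p a. p \<in> V \<Longrightarrow> coord (scale c p) a = c * coord p a"
    and inj: "\<And>p. p \<in> V \<Longrightarrow> (\<And>a. a \<in> A \<Longrightarrow> coord p a = 0) \<Longrightarrow> p = 0"
    and ex: "\<And>a. a \<in> A \<Longrightarrow> \<exists>p\<in>V. \<forall>b\<in>A. coord p b = (if b = a then 1 else 0)"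
  shows "mpol.dim V = card A"
proof -
  obtain e where e: "\<And>a. a \<in> A \<Longrightarrow> e a \<in> V"
      "\<And>a b. a \<in> A \<Longrightarrow> b \<in> A \<Longrightarrow> coord (e a) b = (if b = a then 1 else 0)"
    using ex by metis
  have zero: "coord 0 a = 0" for a
    using scale[of 0 0] mpol.subspace_0[OF V] by simp
  have coord_sum: "coord (\<Sum>a\<in>A. scale (c a) (e a)) b = c b" if "b \<in> A" for c b
  proof -
    \<comment> \<open>Membership in \<open>V\<close> is carried through the induction because
      \<open>coord\<close> is additive only there.\<close>
    have "(\<Sum>a\<in>A'. scale (c a) (e a)) \<in> V \<and>
        coord (\<Sum>a\<in>A'. scale (c a) (e a)) b = (\<Sum>a\<in>A'. c a * coord (e a) b)" if "A' \<subseteq> A" for A'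
      using finite_subset[OF that \<open>finite A\<close>] that
      by (induction A' rule: finite_induct)
        (simp_all add: zero e(1) add scale mpol.subspace_0[OF V] mpol.subspace_add[OF V]
          mpol.subspace_scale[OF V])
    from this[of A] show ?thesis
      using that \<open>finite A\<close> e(2) by (simp add: if_distrib cong: if_cong)
  qed
  have inj_e: "inj_on e A"
    using e(2) by (intro inj_onI) (metis zero_neq_one)
  have "mpol.independent (e ` A)"
  proof (rule mpol.independent_if_scalars_zero)
    show "finite (e ` A)" using \<open>finite A\<close> by simp
    fix c x assume *: "(\<Sum>x\<in>e ` A. scale (c x) x) = 0" and "x \<in> e ` A"
    then obtain a where "a \<in> A" "x = e a" by auto
    moreover have "(\<Sum>a\<in>A. scale (c (e a)) (e a)) = 0"
      using * by (simp add: sum.reindex[OF inj_e])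
    ultimately show "c x = 0"
      using coord_sum[of a "\<lambda>a. c (e a)"] zero by simp
  qed
  moreover have "p \<in> mpol.span (e ` A)" if "p \<in> V" for p
  proof -
    let ?s = "\<Sum>a\<in>A. scale (coord p a) (e a)"
    have s: "?s \<in> V"
      by (intro mpol.subspace_sum[OF V] mpol.subspace_scale[OF V] e(1))
    have s': "scale (-1) ?s \<in> V" by (rule mpol.subspace_scale[OF V s])
    \<comment> \<open>All coordinates of \<open>p\<close> minus its expansion vanish. The difference
      is written with \<open>scale (-1)\<close> because \<open>coord\<close> is known to respect
      just sums and scalars.\<close>
    have "p + scale (-1) ?s = 0"
    proof (rule inj)
      show "coord (p + scale (-1) ?s) a = 0" if "a \<in> A" for a
        using \<open>p \<in> V\<close> that by (simp only: add[OF _ s'] scale[OF s] coord_sum) simp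
    qed (rule mpol.subspace_add[OF V that s'])
    then have "p = ?s" by (simp add: mpol.scale_minus_left)
    also have "\<dots> \<in> mpol.span (e ` A)"
      by (intro mpol.span_sum mpol.span_scale mpol.span_base) auto
    finally show ?thesis .
  qed
  ultimately have "mpol.dim V = card (e ` A)"
    using e(1) by (intro mpol.dim_unique[OF _ _ _ refl]) auto
  then show ?thesis by (simp add: card_image[OF inj_e])
qed

text \<open>The monomial basis of the degree k part of the direct sum: \<open>(i, u)\<close> stands
  for \<open>u\<close> in the summand of index i.\<close>

definition dsum_monomials :: "(nat set \<times> nat) list \<Rightarrow> nat \<Rightarrow> (nat \<times> monom) set" where
  "dsum_monomials D k =
    (SIGMA i:{..<length D}. {u. Poly_Mapping.keys u \<subseteq> fst (D ! i) \<and> mdeg u + snd (D ! i) = k})"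

definition decomposition_series :: "(nat set \<times> nat) list \<Rightarrow> int fps" where
  "decomposition_series D = (\<Sum>i<length D. fps_X ^ snd (D ! i) * geom ^ card (fst (D ! i)))"

lemma finite_dsum_monomials:
  assumes "\<And>Z s. (Z, s) \<in> set D \<Longrightarrow> finite Z"
  shows "finite (dsum_monomials D k)"
proof -
  have "finite (fst (D ! i))" if "i < length D" for i
    using assms[of "fst (D ! i)" "snd (D ! i)"] that by simp
  then show ?thesis
    unfolding dsum_monomials_def
    by (intro finite_SigmaI finite_monomials_of_degree_shift) auto
qed

lemma card_dsum_monomials:
  assumes "\<And>Z s. (Z, s) \<in> set D \<Longrightarrow> finite Z"
  shows "int (card (dsum_monomials D k)) = fps_nth (decomposition_series D) k"
proof -
  have fin: "finite (fst (D ! i))" if "i < length D" for i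
    using assms[of "fst (D ! i)" "snd (D ! i)"] that by simp
  then show ?thesis
    unfolding dsum_monomials_def decomposition_series_def
    by (subst card_SigmaI)
      (auto simp: fps_sum_nth card_monomials_of_degree_shift finite_monomials_of_degree_shift)
qed

text \<open>The coefficients of \<open>\<phi> p\<close> at the pairs in
  \<open>dsum_monomials D k\<close> are coordinates on the degree k part of \<open>I\<close>;
  preimages of the monomial basis form the dual family.\<close>

lemma hilbert_series_if_decomposition:
  fixes I :: "'k::field mpol set"
  assumes I: "is_ideal n I" and dec: "hilbert_decomposition n I D \<phi>"
  shows "hilbert_series I = decomposition_series D"
proof (rule fps_ext)
  fix k
  have fin: "finite Z" if "(Z, s) \<in> set D" for Z s
    using dec that finite_subset[of Z "{1..n}"] by (auto simp: hilbert_decomposition_def)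
  have add: "\<phi> (p + q) i = \<phi> p i + \<phi> q i" if "p \<in> I" "q \<in> I" for p q i
    using dec that by (auto simp: hilbert_decomposition_def)
  have scale: "\<phi> (scale a p) i = scale a (\<phi> p i)" if "p \<in> I" for p a i
    using dec that by (auto simp: hilbert_decomposition_def)
  have part: "\<phi> ` graded_part I k = dsum_part D k"
    using dec by (auto simp: hilbert_decomposition_def)
  have inj: "inj_on \<phi> I"
    using dec by (auto simp: hilbert_decomposition_def bij_betw_def)
  have zI: "0 \<in> I" using I by (simp add: is_ideal_def)
  have zero: "\<phi> 0 = (\<lambda>_. 0)"
    using scale[OF zI, of 0] by (simp add: fun_eq_iff)
  have sub: "p \<in> I" if "p \<in> graded_part I k" for p
    using that by (simp add: graded_part_def)
  have "mpol.dim (graded_part I k) = card (dsum_monomials D k)"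
  proof (rule dim_eq_card_coordinates[where coord = "\<lambda>p (i, u). Poly_Mapping.lookup (\<phi> p i) u"])
    show "finite (dsum_monomials D k)" using fin by (rule finite_dsum_monomials)
    show "mpol.subspace (graded_part I k)" using I by (rule graded_part_subspace)
  next
    fix p
    assume p: "p \<in> graded_part I k"
      and *: "\<And>a. a \<in> dsum_monomials D k \<Longrightarrow> (case a of (i, u) \<Rightarrow> Poly_Mapping.lookup (\<phi> p i) u) = 0"
    have \<phi>p: "\<phi> p \<in> dsum_part D k" using p part by auto
    have "\<phi> p i = 0" for i
    proof (cases "i < length D")
      case True
      have "Poly_Mapping.lookup (\<phi> p i) u = 0" for u
      proof (cases "u \<in> Poly_Mapping.keys (\<phi> p i)")
        case u: True
        then have "(i, u) \<in> dsum_monomials D k"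
          using \<phi>p True by (simp add: dsum_part_def dsum_def dsum_monomials_def poly_ring_in_def)
        then show ?thesis using *[of "(i, u)"] by simp
      qed (simp add: in_keys_iff)
      then show ?thesis by (intro poly_mapping_eqI) simp
    qed (use \<phi>p in \<open>auto simp: dsum_part_def dsum_def\<close>)
    then have "\<phi> p = \<phi> 0" by (simp add: zero fun_eq_iff)
    then show "p = 0" using inj sub[OF p] zI by (auto dest: inj_onD)
  next
    fix a assume "a \<in> dsum_monomials D k"
    then obtain i u where a: "a = (i, u)" "i < length D" "Poly_Mapping.keys u \<subseteq> fst (D ! i)"
        "mdeg u + snd (D ! i) = k"
      by (auto simp: dsum_monomials_def)
    define f where "f = (\<lambda>j. if j = i then Poly_Mapping.single u (1 :: 'k) else 0)"
    have "f \<in> dsum_part D k"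
      using a by (auto simp: f_def dsum_part_def dsum_def poly_ring_in_def)
    then obtain p where "p \<in> graded_part I k" "\<phi> p = f"
      using part by (metis imageE)
    then show "\<exists>p\<in>graded_part I k. \<forall>b\<in>dsum_monomials D k.
        (case b of (i, u) \<Rightarrow> Poly_Mapping.lookup (\<phi> p i) u) = (if b = a then 1 else 0)"
      by (intro bexI[of _ p]) (auto simp: f_def a(1) lookup_single when_def split: if_splits)
  qed (auto simp: add scale sub lookup_add lookup_scale)
  then show "fps_nth (hilbert_series I) k = fps_nth (decomposition_series D) k"
    using card_dsum_monomials[of D k] fin by (simp add: hilbert_series_def hilbert_function_def)
qed

lemma hom_component_in_graded_part:
  "graded_ideal n I \<Longrightarrow> p \<in> I \<Longrightarrow> hom_component k p \<in> graded_part I k"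
  by (auto simp: graded_ideal_def graded_part_def homogeneous_hom_component)

text \<open>Finiteness holds because the degree k part of an ideal of \<open>poly_ring n\<close>
  lies in the span of the finitely many monomials of degree k in n variables.\<close>

lemma graded_part_basis:
  fixes I :: "'k::field mpol set"
  assumes "is_ideal n I"
  obtains B where "finite B" "mpol.independent B" "B \<subseteq> graded_part I k" "graded_part I k \<subseteq> mpol.span B"
    "card B = hilbert_function I k"
proof -
  obtain B where B: "B \<subseteq> graded_part I k" "mpol.independent B" "graded_part I k \<subseteq> mpol.span B"
      "card B = mpol.dim (graded_part I k)"
    using mpol.basis_exists[of "graded_part I k"] .
  have "p \<in> mpol.span (mono_poly ` monomials_of_degree {1..n} k)" if "p \<in> graded_part I k" for p
  proof -
    have "(\<Sum>u\<in>Poly_Mapping.keys p. scale (Poly_Mapping.lookup p u) (mono_poly u))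
        \<in> mpol.span (mono_poly ` monomials_of_degree {1..n} k)"
    proof (intro mpol.span_sum mpol.span_scale mpol.span_base imageI)
      fix u assume "u \<in> Poly_Mapping.keys p"
      then show "u \<in> monomials_of_degree {1..n} k"
        using that assms by (auto simp: monomials_of_degree_def graded_part_def homogeneous_def
            is_ideal_def poly_ring_in_def)
    qed
    then show ?thesis using poly_mapping_sum_mono_poly[of p] by simp
  qed
  then have "B \<subseteq> mpol.span (mono_poly ` monomials_of_degree {1..n} k)"
    using B(1) by blast
  then have "finite B"
    using mpol.independent_span_bound[OF _ B(2)] finite_monomials_of_degree[of "{1..n}" k] by auto
  then show ?thesis using that B by (simp add: hilbert_function_def)
qed

text \<open>In each degree, a basis of the graded part of \<open>I\<close> is matched with the monomial basis of the
  direct sum.\<close>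

lemma decomposition_if_hilbert_series:
  fixes I :: "'k::field mpol set"
  assumes gI: "graded_ideal n I" and D: "\<And>Z s. (Z, s) \<in> set D \<Longrightarrow> Z \<subseteq> {1..n}"
    and series: "hilbert_series I = decomposition_series D"
  shows "\<exists>\<phi>. hilbert_decomposition n I D \<phi>"
proof -
  let ?A = "dsum_monomials D"
  have I: "is_ideal n I" using gI by (simp add: graded_ideal_def)
  note sI = ideal_subspace[OF I]
  have fin_Z: "finite Z" if "(Z, s) \<in> set D" for Z s
    using D[OF that] by (rule finite_subset) simp
  have fin_A: "finite (?A k)" for k
    using fin_Z by (rule finite_dsum_monomials)
  have "\<exists>B. finite B \<and> mpol.independent B \<and> B \<subseteq> graded_part I k \<and> graded_part I k \<subseteq> mpol.span B \<and>
      card B = hilbert_function I k" for k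
    using graded_part_basis[OF I] by metis
  then obtain B where B: "finite (B k)" "mpol.independent (B k)" "B k \<subseteq> graded_part I k"
      "graded_part I k \<subseteq> mpol.span (B k)" "card (B k) = hilbert_function I k" for k
    by metis
  have "card (?A k) = card (B k)" for k
    using card_dsum_monomials[of D k] fin_Z
    by (simp add: B(5) hilbert_series_def flip: series)
  then have "\<exists>\<tau>. bij_betw \<tau> (?A k) (B k)" for k
    using finite_same_card_bij[OF fin_A B(1)] by blast
  then obtain \<tau> where \<tau>: "bij_betw (\<tau> k) (?A k) (B k)" for k
    by metis
  \<comment> \<open>The shifted degree of a pair. The sets \<open>?A k\<close> are its fibres on
    \<open>S\<close>, so a pair determines which \<open>\<tau> k\<close> and \<open>B k\<close>
    apply to it.\<close>
  define deg where "deg = (\<lambda>(i, u). mdeg u + snd (D ! i))"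
  define S where "S = (\<Union>k. ?A k)"
  have A_iff: "x \<in> ?A k \<longleftrightarrow> x \<in> S \<and> deg x = k" for x k
    by (auto simp: S_def dsum_monomials_def deg_def)
  define rep where "rep = (\<lambda>k p. mpol.representation (B k) (hom_component k p))"
  \<comment> \<open>The coordinate of \<open>p\<close> at the basis element matched with
    \<open>x\<close>. The value 0 outside \<open>S\<close> forces \<open>\<phi> p\<close> into the
    direct sum.\<close>
  define cf where "cf = (\<lambda>p x. if x \<in> S then rep (deg x) p (\<tau> (deg x) x) else 0)"
  define \<phi> where "\<phi> = (\<lambda>p i. Abs_poly_mapping (\<lambda>u. cf p (i, u)))"
  have span: "hom_component k p \<in> mpol.span (B k)" if "p \<in> I" for p k
    using B(4) hom_component_in_graded_part[OF gI that] by blast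
  \<comment> \<open>Only degrees of monomials of \<open>p\<close> contribute, and each has finitely
    many pairs; \<open>Abs_poly_mapping\<close> relies on this finite support.\<close>
  have fin_cf: "finite {u. cf p (i, u) \<noteq> 0}" for p i
  proof (rule finite_subset)
    show "{u. cf p (i, u) \<noteq> 0} \<subseteq> (\<Union>k\<in>mdeg ` Poly_Mapping.keys p. snd ` ?A k)"
    proof
      fix u assume "u \<in> {u. cf p (i, u) \<noteq> 0}"
      then have x: "(i, u) \<in> ?A (deg (i, u))" and "rep (deg (i, u)) p \<noteq> (\<lambda>_. 0)"
        unfolding A_iff by (auto simp: cf_def split: if_splits)
      then have "hom_component (deg (i, u)) p \<noteq> 0"
        by (auto simp: rep_def mpol.representation_zero)
      then obtain v where "Poly_Mapping.lookup (hom_component (deg (i, u)) p) v \<noteq> 0"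
        using poly_mapping_eqI[of "hom_component (deg (i, u)) p" 0] by auto
      then have "v \<in> Poly_Mapping.keys p" "mdeg v = deg (i, u)"
        by (auto simp: lookup_hom_component in_keys_iff split: if_splits)
      then show "u \<in> (\<Union>k\<in>mdeg ` Poly_Mapping.keys p. snd ` ?A k)"
        using x by force
    qed
  qed (use fin_A in auto)
  have lookup_\<phi>: "Poly_Mapping.lookup (\<phi> p i) u = cf p (i, u)" for p i u
    using fin_cf[of p i] by (simp add: \<phi>_def)
  have cf_add: "cf (p + q) x = cf p x + cf q x" if "p \<in> I" "q \<in> I" for p q x
    using that by (simp add: cf_def rep_def hom_component_add mpol.representation_add[OF B(2) span span])
  have cf_scale: "cf (scale a p) x = a * cf p x" if "p \<in> I" for a p x
    using that by (simp add: cf_def rep_def hom_component_scale mpol.representation_scale[OF B(2) span])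
  have \<phi>_dsum: "\<phi> p \<in> dsum D" for p
  proof -
    have "(i, u) \<in> S" if "Poly_Mapping.lookup (\<phi> p i) u \<noteq> 0" for i u
      using that by (auto simp: lookup_\<phi> cf_def split: if_splits)
    then have "u \<in> {u. i < length D \<and> Poly_Mapping.keys u \<subseteq> fst (D ! i)}"
      if "u \<in> Poly_Mapping.keys (\<phi> p i)" for i u
      using that by (fastforce simp: S_def dsum_monomials_def simp flip: lookup_not_eq_zero_eq_in_keys)
    then show ?thesis
      by (fastforce simp: dsum_def poly_ring_in_def in_keys_iff intro!: poly_mapping_eqI)
  qed
  have hom_zero: "hom_component k p = 0" if "p \<in> I" and *: "\<And>x. x \<in> ?A k \<Longrightarrow> cf p x = 0" for p k
  proof -
    have "rep k p b = 0" if "b \<in> B k" for b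
    proof -
      have "b \<in> \<tau> k ` ?A k"
        using that bij_betw_imp_surj_on[OF \<tau>[of k]] by simp
      then obtain x where x: "x \<in> ?A k" "b = \<tau> k x"
        by (rule imageE)
      have "x \<in> S" "deg x = k" using x(1) A_iff by blast+
      then show ?thesis using *[OF x(1)] x(2) by (simp add: cf_def)
    qed
    moreover have "(\<Sum>b\<in>B k. scale (rep k p b) b) = hom_component k p"
      unfolding rep_def by (rule mpol.sum_representation_eq[OF B(2) span[OF \<open>p \<in> I\<close>] B(1) order_refl])
    ultimately show ?thesis by simp
  qed
  have \<phi>_eq_imp: "p = q" if "p \<in> I" "q \<in> I" "\<phi> p = \<phi> q" for p q
  proof -
    have mI: "scale (-1) q \<in> I" by (rule mpol.subspace_scale[OF sI that(2)])
    have pq: "p + scale (-1) q \<in> I" by (rule mpol.subspace_add[OF sI that(1) mI])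
    have "cf p x = cf q x" for x
      using that(3) lookup_\<phi>[of _ "fst x" "snd x"] by (metis prod.collapse)
    then have "cf (p + scale (-1) q) x = 0" for x
      by (simp only: cf_add[OF that(1) mI] cf_scale[OF that(2)]) simp
    then have "p + scale (-1) q = 0"
      by (rule eq_0_if_hom_components_eq_0[of "p + scale (-1) q", OF hom_zero[OF pq]])
    then show ?thesis by (simp add: mpol.scale_minus_left)
  qed
  have surj: "\<exists>p\<in>I. \<phi> p = f" if f: "f \<in> dsum D" for f
  proof -
    \<comment> \<open>The preimage of \<open>f\<close> is obtained by replacing each monomial of
      \<open>f\<close> with its matched basis element.\<close>
    define T where "T = (SIGMA i:{..<length D}. Poly_Mapping.keys (f i))"
    define p where "p = (\<Sum>x\<in>T. scale (Poly_Mapping.lookup (f (fst x)) (snd x)) (\<tau> (deg x) x))"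
    have fin_T: "finite T" by (simp add: T_def)
    have TS: "T \<subseteq> S"
      using f by (auto simp: T_def S_def dsum_monomials_def dsum_def poly_ring_in_def)
    have \<tau>B: "\<tau> (deg x) x \<in> B (deg x)" if "x \<in> S" for x
      using \<tau>[of "deg x"] that A_iff[of x "deg x"] by (auto simp: bij_betw_def)
    have \<tau>I: "\<tau> (deg x) x \<in> graded_part I (deg x)" if "x \<in> S" for x
      using \<tau>B[OF that] B(3) by blast
    have pI: "p \<in> I"
      unfolding p_def using TS \<tau>I
      by (intro mpol.subspace_sum[OF sI] mpol.subspace_scale[OF sI]) (auto simp: graded_part_def)
    have cf_\<tau>: "cf (\<tau> (deg x) x) y = (if x = y then 1 else 0)" if "x \<in> S" "y \<in> S" for x y
    proof -
      have "hom_component (deg y) (\<tau> (deg x) x) = (if deg x = deg y then \<tau> (deg x) x else 0)"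
        using \<tau>I[OF that(1)] by (simp add: graded_part_def hom_component_homogeneous)
      moreover have "\<tau> (deg x) x = \<tau> (deg x) y \<longleftrightarrow> x = y" if "deg x = deg y"
        using \<tau>[of "deg x"] A_iff[of x "deg x"] A_iff[of y "deg x"] \<open>x \<in> S\<close> \<open>y \<in> S\<close> that
        by (auto simp: bij_betw_def inj_on_def)
      ultimately show ?thesis
        using that \<tau>B[OF that(1)] mpol.representation_basis[OF B(2), of "\<tau> (deg x) x" "deg x"]
        by (auto simp: cf_def rep_def mpol.representation_zero)
    qed
    have "cf p y = (\<Sum>x\<in>T. Poly_Mapping.lookup (f (fst x)) (snd x) * cf (\<tau> (deg x) x) y)" for y
    proof -
      have "(\<Sum>x\<in>T'. scale (Poly_Mapping.lookup (f (fst x)) (snd x)) (\<tau> (deg x) x)) \<in> I \<and>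
        cf (\<Sum>x\<in>T'. scale (Poly_Mapping.lookup (f (fst x)) (snd x)) (\<tau> (deg x) x)) y =
        (\<Sum>x\<in>T'. Poly_Mapping.lookup (f (fst x)) (snd x) * cf (\<tau> (deg x) x) y)" if "T' \<subseteq> T" for T'
        using finite_subset[OF that fin_T] that
      proof (induction T' rule: finite_induct)
        case empty
        show ?case
          using mpol.subspace_0[OF sI] by (simp add: cf_def rep_def mpol.representation_zero)
      next
        case (insert x T')
        then have "\<tau> (deg x) x \<in> I" using \<tau>I[of x] TS by (auto simp: graded_part_def)
        then show ?case
          using insert by (simp add: cf_add cf_scale mpol.subspace_add[OF sI] mpol.subspace_scale[OF sI])
      qed
      then show ?thesis by (simp add: p_def)
    qed
    then have cf_p: "cf p y = (\<Sum>x\<in>T. if x = y then Poly_Mapping.lookup (f (fst x)) (snd x) else 0)"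
      if "y \<in> S" for y
      using TS that by (auto simp: cf_\<tau> subset_iff intro!: sum.cong)
    have "Poly_Mapping.lookup (\<phi> p i) u = Poly_Mapping.lookup (f i) u" for i u
    proof (cases "(i, u) \<in> S")
      case True
      then have "i < length D" by (auto simp: S_def dsum_monomials_def)
      then show ?thesis
        using fin_T by (simp add: lookup_\<phi> cf_p[OF True] T_def in_keys_iff)
    next
      case False
      then have "(i, u) \<notin> T" using TS by auto
      then have "Poly_Mapping.lookup (f i) u = 0"
        using f by (cases "i < length D") (auto simp: T_def in_keys_iff dsum_def)
      then show ?thesis using False by (simp add: lookup_\<phi> cf_def)
    qed
    then have "\<phi> p = f" by (auto intro!: poly_mapping_eqI)
    then show ?thesis using pI by blast
  qed
  have part: "\<phi> p \<in> dsum_part D k \<longleftrightarrow> homogeneous k p" if "p \<in> I" for p k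
  proof
    assume "homogeneous k p"
    then have "mdeg u + snd (D ! i) = k" if "cf p (i, u) \<noteq> 0" for i u
      using that by (auto simp: cf_def rep_def deg_def hom_component_homogeneous
          mpol.representation_zero split: if_splits)
    then show "\<phi> p \<in> dsum_part D k"
      using \<phi>_dsum[of p] by (auto simp: dsum_part_def in_keys_iff lookup_\<phi>)
  next
    assume \<phi>p: "\<phi> p \<in> dsum_part D k"
    show "homogeneous k p"
    proof (rule homogeneousI, rule hom_zero[OF that])
      fix j x assume "j \<noteq> k" "x \<in> ?A j"
      then show "cf p x = 0"
        using \<phi>p lookup_\<phi>[of p]
        by (cases x) (force simp: dsum_part_def dsum_monomials_def simp flip: lookup_not_eq_zero_eq_in_keys)
    qed
  qed
  have "hilbert_decomposition n I D \<phi>"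
    unfolding hilbert_decomposition_def
  proof (intro conjI allI ballI)
    show "bij_betw \<phi> I (dsum D)"
      using \<phi>_eq_imp \<phi>_dsum surj by (fastforce simp: bij_betw_def inj_on_def)
    show "\<phi> ` graded_part I k = dsum_part D k" for k
    proof (intro equalityI subsetI)
      fix f :: "nat \<Rightarrow> 'k mpol" assume f: "f \<in> dsum_part D k"
      then obtain p where "p \<in> I" "\<phi> p = f" using surj[of f] by (auto simp: dsum_part_def)
      then show "f \<in> \<phi> ` graded_part I k" using part[of p k] f by (auto simp: graded_part_def)
    qed (auto simp: graded_part_def part)
  qed (use D in \<open>auto simp: lookup_add lookup_scale lookup_\<phi> cf_add cf_scale intro!: poly_mapping_eqI\<close>)
  then show ?thesis by blast
qed

section \<open>Stable sets of monomials\<close>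

lemma keys_minus_subset: "Poly_Mapping.keys (u - v) \<subseteq> Poly_Mapping.keys (u :: monom)"
  by (auto simp: in_keys_iff lookup_minus)

lemma max_var_in_keys: "u \<noteq> 0 \<Longrightarrow> max_var u \<in> Poly_Mapping.keys u"
  by (auto simp: max_var_def intro!: Max_in poly_mapping_eqI simp: in_keys_iff)

lemma max_var_ge: "i \<in> Poly_Mapping.keys u \<Longrightarrow> i \<le> max_var u"
  by (simp add: max_var_def)

text \<open>The monomials of a proper stable ideal in the sense of Eliahou and Kervaire. By
  \<open>zero_notin\<close>, \<open>max_var\<close> is never applied to the monomial 1 on
  \<open>A\<close>.\<close>

locale stable_set =
  fixes n :: nat and A :: "monom set"
  assumes subset_monomials: "A \<subseteq> monomials n"
    and add_closed: "\<And>u v. u \<in> A \<Longrightarrow> v \<in> monomials n \<Longrightarrow> u + v \<in> A"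
    and swap_closed: "\<And>u j. u \<in> A \<Longrightarrow> 1 \<le> j \<Longrightarrow> j < max_var u \<Longrightarrow>
      u - Poly_Mapping.single (max_var u) 1 + Poly_Mapping.single j 1 \<in> A"
    and zero_notin: "0 \<notin> A"
begin

text \<open>Each monomial of \<open>A\<close> factors uniquely as \<open>u v\<close> with \<open>u\<close> in this set and \<open>v\<close> a monomial in
  \<open>x\<^sub>i\<close>, \<open>i \<ge> max_var u\<close> (Eliahou and Kervaire); \<open>u\<close> is the first prefix lying in \<open>A\<close> of the word of
  variables in increasing order.\<close>

definition gens :: "monom set" where
  "gens = {u \<in> A. u - Poly_Mapping.single (max_var u) 1 \<notin> A}"

text \<open>Let j be a variable of \<open>v\<close> and M the largest one of uv. If j = M, the
  quotient is still a multiple of \<open>u\<close>. Otherwise uv/x_j lies in \<open>A\<close> with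
  largest variable M, and exchanging x_M for x_j gives uv/x_M. Hence no proper multiple of an
  element of \<open>A\<close> is in \<open>gens\<close>.\<close>

lemma multiple_minus_max_var:
  assumes "u \<in> A" "v \<in> monomials n" "v \<noteq> 0"
  shows "(u + v) - Poly_Mapping.single (max_var (u + v)) 1 \<in> A"
proof -
  obtain j where j: "j \<in> Poly_Mapping.keys v"
    using assms(3) max_var_in_keys by blast
  let ?v = "v - Poly_Mapping.single j 1" and ?M = "max_var (u + v)"
  have v: "v = ?v + Poly_Mapping.single j 1"
    using single_diff_add[OF j] by simp
  have w': "u + ?v \<in> A"
    using assms keys_minus_subset[of v "Poly_Mapping.single j 1"] by (intro add_closed) auto
  have jM: "j \<le> ?M" using j by (intro max_var_ge) (simp add: keys_add_nat)
  show ?thesis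
  proof (cases "j = ?M")
    case True
    have "(u + v) - Poly_Mapping.single j 1 = u + ?v"
      using v by (metis add.assoc add_diff_cancel_right')
    then show ?thesis using w' True by simp
  next
    case False
    have M: "?M \<in> Poly_Mapping.keys (u + v)"
      using assms(3) by (intro max_var_in_keys) (metis mdeg_add mdeg_eq_0_iff add_is_0)
    have "max_var (u + ?v) = ?M"
      unfolding max_var_def[of "u + ?v"]
    proof (rule Max_eqI)
      show "?M \<in> Poly_Mapping.keys (u + ?v)"
        using M False by (auto simp: in_keys_iff lookup_add lookup_minus lookup_single when_def)
    next
      fix i assume "i \<in> Poly_Mapping.keys (u + ?v)"
      then show "i \<le> ?M"
        by (intro max_var_ge) (auto simp: in_keys_iff lookup_add lookup_minus)
    qed simp
    moreover have "1 \<le> j" using j assms(2) by auto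
    ultimately have "u + ?v - Poly_Mapping.single ?M 1 + Poly_Mapping.single j 1 \<in> A"
      using swap_closed[OF w', of j] False jM by simp
    also have "u + ?v - Poly_Mapping.single ?M 1 + Poly_Mapping.single j 1 =
        (u + v) - Poly_Mapping.single ?M 1"
      using j M False by (intro poly_mapping_eqI)
        (auto simp: in_keys_iff lookup_add lookup_minus lookup_single when_def)
    finally show ?thesis .
  qed
qed

lemma multiple_in_gens:
  assumes "u \<in> A" "v \<in> monomials n" "u + v \<in> gens"
  shows "v = 0"
  using multiple_minus_max_var[of u v] assms by (auto simp: gens_def)

text \<open>Strip the largest variable until the next removal would leave \<open>A\<close>. What
  remains is \<open>u\<close>; it divides every earlier stage, so the stripped variables have index
  at least \<open>max_var u\<close>.\<close>

lemma factorization_exists: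
  assumes "w \<in> A"
  shows "\<exists>u\<in>gens. \<exists>v. w = u + v \<and> Poly_Mapping.keys v \<subseteq> {max_var u..n}"
  using assms
proof (induction "mdeg w" arbitrary: w rule: less_induct)
  case less
  let ?e = "Poly_Mapping.single (max_var w) (1 :: nat)"
  show ?case
  proof (cases "w - ?e \<in> A")
    case False
    then show ?thesis
      using less.prems by (intro bexI[of _ w] exI[of _ 0]) (auto simp: gens_def)
  next
    case True
    have M: "max_var w \<in> Poly_Mapping.keys w"
      using less.prems zero_notin by (intro max_var_in_keys) auto
    have w: "w - ?e + ?e = w" by (rule single_diff_add[OF M])
    have "mdeg (w - ?e) < mdeg w"
      using mdeg_add[of "w - ?e" ?e] unfolding w by simp
    then obtain u v where uv: "u \<in> gens" "w - ?e = u + v" "Poly_Mapping.keys v \<subseteq> {max_var u..n}"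
      using less.hyps True by blast
    have wuv: "w = u + (v + ?e)" using w uv(2) by (metis add.assoc)
    have "u \<noteq> 0" using uv(1) zero_notin by (auto simp: gens_def)
    moreover have "Poly_Mapping.keys w = Poly_Mapping.keys u \<union> Poly_Mapping.keys (v + ?e)"
      by (rule trans[OF arg_cong[OF wuv, of Poly_Mapping.keys] keys_add_nat])
    ultimately have "max_var u \<in> Poly_Mapping.keys w"
      using max_var_in_keys by blast
    then have "max_var u \<le> max_var w" by (rule max_var_ge)
    moreover have "max_var w \<le> n" using M less.prems subset_monomials by fastforce
    ultimately have "Poly_Mapping.keys (v + ?e) \<subseteq> {max_var u..n}"
      using uv(3) by (auto simp: keys_add_nat)
    then show ?thesis using uv(1) wuv by blast
  qed
qed

text \<open>Under \<open>le\<close>, \<open>u\<close> divides \<open>u'\<close>: below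
  \<open>max_var u\<close> neither \<open>v\<close> nor \<open>v'\<close> contributes, above it
  \<open>u\<close> has no exponent, and at that index \<open>le\<close> decides. A multiple of
  \<open>u\<close> in \<open>gens\<close> is \<open>u\<close> itself.\<close>

lemma factorization_unique_aux:
  assumes gens: "u \<in> gens" "u' \<in> gens" and eq: "u + v = u' + v'"
    and v: "Poly_Mapping.keys v \<subseteq> {max_var u..n}" and v': "Poly_Mapping.keys v' \<subseteq> {max_var u'..n}"
    and le: "max_var u < max_var u' \<or>
      max_var u = max_var u' \<and> Poly_Mapping.lookup u (max_var u) \<le> Poly_Mapping.lookup u' (max_var u)"
  shows "u = u'"
proof -
  have A: "u \<in> A" "u' \<in> A" using gens by (auto simp: gens_def)
  have eq_i: "Poly_Mapping.lookup u i + Poly_Mapping.lookup v i =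
      Poly_Mapping.lookup u' i + Poly_Mapping.lookup v' i" for i
    using eq by (metis lookup_add)
  have below: "Poly_Mapping.lookup v i = 0" if "i < max_var u" for i
    using v that by (fastforce simp: in_keys_iff)
  have below': "Poly_Mapping.lookup v' i = 0" if "i < max_var u'" for i
    using v' that by (fastforce simp: in_keys_iff)
  have above: "Poly_Mapping.lookup u i = 0" if "i > max_var u" for i
    using max_var_ge[of i u] that by (auto simp: in_keys_iff)
  have "Poly_Mapping.lookup u i \<le> Poly_Mapping.lookup u' i" for i
    using eq_i[of i] below[of i] below'[of i] above[of i] le
    by (cases i "max_var u" rule: linorder_cases) auto
  then have u': "u + (u' - u) = u'" by (rule monom_diff_add)
  have "u' - u \<in> monomials n"
    using A(2) subset_monomials keys_minus_subset[of u' u] by blast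
  then have "u' - u = 0"
    using multiple_in_gens[OF A(1), of "u' - u"] gens(2) u' by simp
  then show ?thesis using u' by simp
qed

lemma factorization_unique:
  assumes "u \<in> gens" "u' \<in> gens" "u + v = u' + v'"
    and "Poly_Mapping.keys v \<subseteq> {max_var u..n}" "Poly_Mapping.keys v' \<subseteq> {max_var u'..n}"
  shows "u = u'"
proof (rule linorder_cases[of "max_var u" "max_var u'"])
  assume "max_var u = max_var u'"
  then show ?thesis
    using factorization_unique_aux[of u u' v v'] factorization_unique_aux[of u' u v' v] assms
    by (metis nat_le_linear)
qed (use factorization_unique_aux[of u u' v v'] factorization_unique_aux[of u' u v' v] assms in auto)

lemma max_var_gens:
  assumes "u \<in> gens"
  shows "1 \<le> max_var u" "max_var u \<le> n"
  using assms max_var_in_keys[of u] subset_monomials zero_notin by (fastforce simp: gens_def)+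

lemma card_of_degree:
  assumes "finite gens"
  shows "card {w \<in> A. mdeg w = k} =
    (\<Sum>u\<in>gens. card {v. Poly_Mapping.keys v \<subseteq> {max_var u..n} \<and> mdeg v + mdeg u = k})"
proof -
  let ?V = "\<lambda>u. {v. Poly_Mapping.keys v \<subseteq> {max_var u..n} \<and> mdeg v + mdeg u = k}"
  have inj: "inj_on (\<lambda>(u, v). u + v) (SIGMA u:gens. ?V u)"
  proof (rule inj_onI, clarsimp)
    fix u v u' v' assume *: "u \<in> gens" "u' \<in> gens" "u + v = u' + v'"
      "Poly_Mapping.keys v \<subseteq> {max_var u..n}" "Poly_Mapping.keys v' \<subseteq> {max_var u'..n}"
    from factorization_unique[OF this] *(3) show "u = u' \<and> v = v'" by simp
  qed
  have "(\<lambda>(u, v). u + v) ` (SIGMA u:gens. ?V u) = {w \<in> A. mdeg w = k}"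
  proof (intro equalityI subsetI)
    fix w assume "w \<in> {w \<in> A. mdeg w = k}"
    then obtain u v where "u \<in> gens" "w = u + v" "Poly_Mapping.keys v \<subseteq> {max_var u..n}" "mdeg w = k"
      using factorization_exists by blast
    then show "w \<in> (\<lambda>(u, v). u + v) ` (SIGMA u:gens. ?V u)"
      by (force simp: mdeg_add)
  next
    fix w assume "w \<in> (\<lambda>(u, v). u + v) ` (SIGMA u:gens. ?V u)"
    then obtain u v where uv: "w = u + v" "u \<in> gens" "Poly_Mapping.keys v \<subseteq> {max_var u..n}"
        "mdeg v + mdeg u = k"
      by auto
    then have "v \<in> monomials n" using max_var_gens[OF uv(2)] by force
    then show "w \<in> {w \<in> A. mdeg w = k}"
      using uv add_closed by (auto simp: gens_def mdeg_add)
  qed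
  then have "card {w \<in> A. mdeg w = k} = card (SIGMA u:gens. ?V u)"
    using card_image[OF inj] by simp
  also have "\<dots> = (\<Sum>u\<in>gens. card (?V u))"
    using assms finite_monomials_of_degree_shift by (intro card_SigmaI) auto
  finally show ?thesis .
qed

text \<open>The Eliahou-Kervaire formula: the cofactors of \<open>u\<close> use n + 1 - max_var u
  variables, so multiplication by (1 - t)^n leaves the exponent max_var u - 1.\<close>

lemma series_of_degrees:
  assumes "finite gens"
  shows "Abs_fps (\<lambda>k. int (card {w \<in> A. mdeg w = k})) * (1 - fps_X) ^ n =
    (\<Sum>u\<in>gens. fps_X ^ mdeg u * (1 - fps_X) ^ (max_var u - 1))"
proof -
  have "Abs_fps (\<lambda>k. int (card {w \<in> A. mdeg w = k})) =
      (\<Sum>u\<in>gens. fps_X ^ mdeg u * geom ^ (Suc n - max_var u))"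
    by (rule fps_ext)
      (simp add: card_of_degree[OF assms] fps_sum_nth card_monomials_of_degree_shift)
  moreover have "fps_X ^ mdeg u * geom ^ (Suc n - max_var u) * (1 - fps_X) ^ n =
      fps_X ^ mdeg u * (1 - fps_X) ^ (max_var u - 1)" if "u \<in> gens" for u
  proof -
    have "(1 - fps_X) ^ n * geom ^ (Suc n - max_var u) = (1 - fps_X) ^ (n - (Suc n - max_var u))"
      using max_var_gens[OF that] by (intro one_minus_X_power_cancel) simp
    moreover have "n - (Suc n - max_var u) = max_var u - 1"
      using max_var_gens[OF that] by simp
    ultimately show ?thesis by (simp add: mult.assoc mult.commute[of _ "(1 - fps_X) ^ n"])
  qed
  ultimately show ?thesis by (simp only: sum_distrib_right cong: sum.cong)
qed

end

section \<open>Lex ideals\<close>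

definition ideal_monomials :: "nat \<Rightarrow> monom set \<Rightarrow> monom set" where
  "ideal_monomials n G = {u \<in> monomials n. \<exists>g\<in>G. \<exists>v. u = g + v}"

lemma is_ideal_ideal_monomials:
  "is_ideal n {p :: 'k::field mpol. Poly_Mapping.keys p \<subseteq> ideal_monomials n G}" (is "is_ideal n ?M")
  unfolding is_ideal_def
proof (intro conjI ballI)
  fix p q :: "'k mpol" assume "p \<in> ?M" "q \<in> ?M"
  then show "p + q \<in> ?M" using keys_add[of p q] by blast
next
  fix f p :: "'k mpol" assume f: "f \<in> poly_ring n" and p: "p \<in> ?M"
  have "w \<in> ideal_monomials n G" if w: "w \<in> Poly_Mapping.keys (f * p)" for w
  proof -
    obtain a b where ab: "w = a + b" "a \<in> Poly_Mapping.keys f" "b \<in> Poly_Mapping.keys p"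
      using w keys_mult[of f p] by blast
    then obtain g v where "g \<in> G" "b = g + v" "Poly_Mapping.keys b \<subseteq> {1..n}"
      using p by (auto simp: ideal_monomials_def subset_iff)
    moreover have "Poly_Mapping.keys a \<subseteq> {1..n}"
      using f ab by (auto simp: poly_ring_in_def)
    moreover have "w = g + (a + v)"
      using \<open>b = g + v\<close> ab(1) by (simp only: add.left_commute)
    ultimately show ?thesis
      unfolding ideal_monomials_def using ab(1) keys_add_nat[of a b] by blast
  qed
  then show "f * p \<in> ?M" by blast
qed (auto simp: poly_ring_in_def ideal_monomials_def)

text \<open>The polynomials supported on multiples of \<open>G\<close> form an ideal containing
  \<open>G\<close>; conversely each of them is a linear combination of monomial multiples of
  generators.\<close>

lemma generated_by_monomials_eq:
  fixes L :: "'k::field mpol set"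
  assumes "generated_by_monomials n L G"
  shows "L = {p. Poly_Mapping.keys p \<subseteq> ideal_monomials n G}" (is "_ = ?M")
proof -
  have G: "G \<subseteq> monomials n" and L: "L = is_ideal n hull (mono_poly ` G)"
    using assms by (auto simp: generated_by_monomials_def)
  have "is_ideal n ?M" by (rule is_ideal_ideal_monomials)
  moreover have "mono_poly ` G \<subseteq> ?M"
  proof (rule image_subsetI)
    fix g assume "g \<in> G"
    moreover have "g = g + 0" by simp
    ultimately have "g \<in> ideal_monomials n G"
      using G unfolding ideal_monomials_def by blast
    then show "mono_poly g \<in> ?M" by (simp add: mono_poly_def)
  qed
  ultimately have "L \<subseteq> ?M" unfolding L by (rule hull_minimal[rotated])
  moreover have "p \<in> t" if p: "p \<in> ?M" and t: "is_ideal n t" "mono_poly ` G \<subseteq> t" for p t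
  proof -
    have "(\<Sum>u\<in>Poly_Mapping.keys p. scale (Poly_Mapping.lookup p u) (mono_poly u)) \<in> t"
    proof (intro mpol.subspace_sum mpol.subspace_scale ideal_subspace[OF t(1)])
      fix u assume "u \<in> Poly_Mapping.keys p"
      then obtain g v where gv: "g \<in> G" "u = g + v" "Poly_Mapping.keys u \<subseteq> {1..n}"
        using p by (auto simp: ideal_monomials_def subset_iff)
      then have "(mono_poly v :: 'k mpol) \<in> poly_ring n"
        by (auto simp: poly_ring_in_def mono_poly_def keys_add_nat)
      then have "mono_poly v * mono_poly g \<in> t"
        using t gv(1) by (auto simp: is_ideal_def)
      then show "mono_poly u \<in> t"
        by (simp add: gv(2) mono_poly_def mult_single add.commute)
    qed
    then show ?thesis using poly_mapping_sum_mono_poly[of p] by simp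
  qed
  then have "?M \<subseteq> L" unfolding L hull_def by blast
  ultimately show ?thesis by blast
qed

lemma hilbert_function_generated_by_monomials:
  fixes L :: "'k::field mpol set"
  assumes L: "L = {p. Poly_Mapping.keys p \<subseteq> A}" and "is_ideal n L" and A: "A \<subseteq> monomials n"
  shows "hilbert_function L k = card {u \<in> A. mdeg u = k}"
  unfolding hilbert_function_def
proof (rule dim_eq_card_coordinates[where coord = Poly_Mapping.lookup])
  show "finite {u \<in> A. mdeg u = k}"
    using A by (intro finite_subset[OF _ finite_monomials_of_degree[of "{1..n}" k]])
      (auto simp: monomials_of_degree_def)
  show "mpol.subspace (graded_part L k)"
    by (rule graded_part_subspace[OF assms(2)])
next
  fix p assume "p \<in> graded_part L k" "\<And>u. u \<in> {u \<in> A. mdeg u = k} \<Longrightarrow> Poly_Mapping.lookup p u = 0"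
  then show "p = 0"
    by (intro poly_mapping_eqI) (fastforce simp: L graded_part_def homogeneous_def in_keys_iff)
next
  fix u assume "u \<in> {u \<in> A. mdeg u = k}"
  then show "\<exists>p\<in>graded_part L k. \<forall>v\<in>{u \<in> A. mdeg u = k}.
      Poly_Mapping.lookup p v = (if v = u then 1 else 0)"
    by (intro bexI[of _ "mono_poly u"])
      (auto simp: L graded_part_def homogeneous_def mono_poly_def lookup_single when_def)
qed (auto simp: lookup_add lookup_scale)

text \<open>Exchanging the largest variable for an earlier one keeps the degree and raises the
  monomial in the lexicographic order.\<close>

lemma lex_ideal_stable:
  fixes L :: "'k::field mpol set"
  assumes lex: "lex_ideal n L" and L: "L = {p. Poly_Mapping.keys p \<subseteq> ideal_monomials n G}"
    and zero: "0 \<notin> ideal_monomials n G"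
  shows "stable_set n (ideal_monomials n G)"
proof
  fix u v assume "u \<in> ideal_monomials n G" "v \<in> monomials n"
  then show "u + v \<in> ideal_monomials n G"
    by (auto simp: ideal_monomials_def keys_add_nat add.assoc) blast
next
  fix u j assume u: "u \<in> ideal_monomials n G" and j: "1 \<le> j" "j < max_var u"
  let ?w = "u - Poly_Mapping.single (max_var u) 1"
  let ?v = "?w + Poly_Mapping.single j 1"
  have mem: "mono_poly u \<in> L \<longleftrightarrow> u \<in> ideal_monomials n G" for u
    by (simp add: L mono_poly_def)
  have "u \<noteq> 0" using u zero by auto
  then have M: "max_var u \<in> Poly_Mapping.keys u" by (rule max_var_in_keys)
  have w: "?w + Poly_Mapping.single (max_var u) 1 = u" by (rule single_diff_add[OF M])
  have un: "u \<in> monomials n" using u by (simp add: ideal_monomials_def)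
  have "?v \<in> monomials n"
    using un M j keys_minus_subset[of u "Poly_Mapping.single (max_var u) 1"]
    by (fastforce simp: keys_add_nat)
  moreover have "mdeg ?v = mdeg u"
    using mdeg_add[of ?w "Poly_Mapping.single (max_var u) 1"] unfolding w by (simp add: mdeg_add)
  moreover have "u < ?v"
  proof -
    \<comment> \<open>Since j < max_var u, the smallest index where the exponents differ is j, and
      there the exponent grows.\<close>
    have "Poly_Mapping.lookup u j < Poly_Mapping.lookup ?v j \<and>
        (\<forall>i<j. Poly_Mapping.lookup u i = Poly_Mapping.lookup ?v i)"
      using j by (auto simp: lookup_add lookup_minus lookup_single when_def)
    then show ?thesis unfolding less_poly_mapping.rep_eq less_fun_def by blast
  qed
  moreover have "mono_poly u \<in> L" using u by (simp only: mem)
  ultimately have "mono_poly ?v \<in> L"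
    using lex un unfolding lex_ideal_def by blast
  then show "?v \<in> ideal_monomials n G" by (simp only: mem)
next
  show "ideal_monomials n G \<subseteq> monomials n"
    unfolding ideal_monomials_def by blast
qed (rule zero)

section \<open>The procedure and the Hilbert depth\<close>

lemma decomposition_series_eq_sum_list:
  "decomposition_series D = (\<Sum>(Z, s)\<leftarrow>D. fps_X ^ s * geom ^ card Z)"
  by (simp add: decomposition_series_def sum_list_sum_nth case_prod_beta atLeast0LessThan)

lemma decomposition_series_concat:
  "decomposition_series (concat (map f xs)) = (\<Sum>x\<leftarrow>xs. decomposition_series (f x))"
  by (induction xs) (simp_all add: decomposition_series_eq_sum_list)

lemma decomposition_series_replicate:
  "decomposition_series (replicate k (Z, s)) = of_nat k * (fps_X ^ s * geom ^ card Z)"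
  by (simp add: decomposition_series_eq_sum_list sum_list_replicate)

lemma decomposition_depth_le:
  assumes "D \<noteq> []" "\<And>Z s. (Z, s) \<in> set D \<Longrightarrow> Z \<subseteq> {1..n}"
  shows "decomposition_depth D \<le> n"
proof -
  have "decomposition_depth D \<in> (\<lambda>(Z, s). card Z) ` set D"
    unfolding decomposition_depth_def using assms(1) by (intro Min_in) auto
  then obtain Z s where "(Z, s) \<in> set D" "decomposition_depth D = card Z" by auto
  then show ?thesis
    using card_mono[of "{1..n}" Z] assms(2) by simp
qed

text \<open>In every summand (1 - t)^k cancels against a denominator of exponent at least k. This
  gives the necessary condition for depth k.\<close>

lemma nonneg_fps_decomposition_series:
  assumes "\<And>Z s. (Z, s) \<in> set D \<Longrightarrow> k \<le> card Z"
  shows "nonneg_fps (decomposition_series D * (1 - fps_X) ^ k)"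
proof -
  have "nonneg_fps (fps_X ^ snd (D ! i) * geom ^ card (fst (D ! i)) * (1 - fps_X) ^ k)"
    if "i < length D" for i
  proof -
    have "k \<le> card (fst (D ! i))" using that by (intro assms[of _ "snd (D ! i)"]) simp
    moreover have "fps_X ^ snd (D ! i) * geom ^ card (fst (D ! i)) * (1 - fps_X) ^ k =
        fps_X ^ snd (D ! i) * ((1 - fps_X) ^ k * geom ^ card (fst (D ! i)))"
      by (simp only: mult_ac)
    ultimately have "fps_X ^ snd (D ! i) * geom ^ card (fst (D ! i)) * (1 - fps_X) ^ k =
        fps_X ^ snd (D ! i) * geom ^ (card (fst (D ! i)) - k)"
      by (simp only: geom_power_cancel)
    then show ?thesis
      using nonneg_fps_mult[OF nonneg_fps_X_power nonneg_fps_geom_power] by (simp only:)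
  qed
  then show ?thesis
    unfolding decomposition_series_def sum_distrib_right by (intro nonneg_fps_sum) simp
qed

text \<open>Take \<open>b i\<close> copies of K[Z](-i) with |Z| = n - k i. Only the size of Z enters
  the series, so an initial segment of the variables serves.\<close>

lemma exists_decomposition_series:
  fixes b :: "nat \<Rightarrow> int"
  assumes "\<And>i. d \<le> i \<Longrightarrow> i \<le> m \<Longrightarrow> b i \<ge> 0" and "\<And>i. k i \<le> n"
  shows "\<exists>D. (\<forall>(Z, s)\<in>set D. Z \<subseteq> {1..n} \<and> (\<exists>i. card Z = n - k i)) \<and>
    decomposition_series D = (\<Sum>i = d..m. fps_const (b i) * (fps_X ^ i * (1 - fps_X) ^ k i)) * geom ^ n"
proof -
  define D where "D = concat (map (\<lambda>i. replicate (nat (b i)) ({1..n - k i}, i)) [d..<Suc m])"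
  have term_eq: "fps_const (b i) * (fps_X ^ i * geom ^ (n - k i)) =
      fps_const (b i) * (fps_X ^ i * (1 - fps_X) ^ k i) * geom ^ n" for i
    using geom_power_cancel[of "k i" n] assms(2)[of i] by (simp only: mult.assoc)
  have "decomposition_series D =
      (\<Sum>i\<leftarrow>[d..<Suc m]. of_nat (nat (b i)) * (fps_X ^ i * geom ^ (n - k i)))"
    unfolding D_def decomposition_series_concat decomposition_series_replicate by simp
  also have "\<dots> = (\<Sum>i\<in>set [d..<Suc m]. of_nat (nat (b i)) * (fps_X ^ i * geom ^ (n - k i)))"
    by (rule sum_list_distinct_conv_sum_set) simp
  also have "\<dots> = (\<Sum>i = d..m. fps_const (b i) * (fps_X ^ i * (1 - fps_X) ^ k i) * geom ^ n)"
  proof (rule sum.cong)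
    fix i assume "i \<in> {d..m}"
    then have b: "int (nat (b i)) = b i"
      using assms(1)[of i] by simp
    have "fps_const (b i) = of_nat (nat (b i))"
      using fps_of_nat[of "nat (b i)", where ?'a = int] unfolding b .
    then show "of_nat (nat (b i)) * (fps_X ^ i * geom ^ (n - k i)) =
        fps_const (b i) * (fps_X ^ i * (1 - fps_X) ^ k i) * geom ^ n"
      using term_eq[of i] by (simp only:)
  qed auto
  finally have "decomposition_series D =
      (\<Sum>i = d..m. fps_const (b i) * (fps_X ^ i * (1 - fps_X) ^ k i)) * geom ^ n"
    by (simp only: sum_distrib_right)
  moreover have "\<forall>(Z, s)\<in>set D. Z \<subseteq> {1..n} \<and> (\<exists>i. card Z = n - k i)"
    by (auto simp: D_def split: if_splits)
  ultimately show ?thesis by blast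
qed

text \<open>The k-th iterate of \<open>Suc\<close> from 0 is k, so the loop tries 0, 1, 2, ... and
  halts at the least value that passes the test.\<close>

lemma final_q_eq_Least:
  assumes "\<forall>i\<in>{d..m}. b_coeff Q d m q i \<ge> 0"
  shows "final_q Q d m = Some (LEAST q. \<forall>i\<in>{d..m}. b_coeff Q d m q i \<ge> 0)"
  using assms unfolding final_q_def while_option_def by (auto simp: Suc_funpow)

text \<open>A nonzero element of degree 0 is a constant, hence a unit. For a proper ideal this keeps
  the monomial 1 out of the lex ideal with the same Hilbert function.\<close>

lemma ideal_eq_poly_ring_if_hilbert_function_0:
  fixes I :: "'k::field mpol set"
  assumes I: "is_ideal n I" and "hilbert_function I 0 \<noteq> 0"
  shows "I = poly_ring n"
proof -
  have "\<not> graded_part I 0 \<subseteq> {0}"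
  proof
    assume "graded_part I 0 \<subseteq> {0}"
    then have "mpol.dim (graded_part I 0) \<le> card ({} :: 'k mpol set)"
      by (intro mpol.dim_le_card) auto
    then show False using assms(2) by (simp add: hilbert_function_def)
  qed
  then obtain p where p: "p \<in> I" "homogeneous 0 p" "p \<noteq> 0"
    by (auto simp: graded_part_def)
  define a where "a = Poly_Mapping.lookup p 0"
  have p_eq: "p = Poly_Mapping.single 0 a"
  proof (rule poly_mapping_eqI)
    fix u
    show "Poly_Mapping.lookup p u = Poly_Mapping.lookup (Poly_Mapping.single 0 a) u"
      using p(2) by (cases "u = 0") (auto simp: a_def lookup_single when_def homogeneous_def in_keys_iff)
  qed
  then have "a \<noteq> 0" using p(3) by auto
  have "scale (inverse a) p \<in> I"
    by (rule mpol.subspace_scale[OF ideal_subspace[OF I] p(1)])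
  also have "scale (inverse a) p = 1"
    using \<open>a \<noteq> 0\<close> by (simp add: scale_def p_eq mult_single)
  finally have "f \<in> I" if "f \<in> poly_ring n" for f
    using I that unfolding is_ideal_def by (metis mult_1_right)
  then show ?thesis using I by (auto simp: is_ideal_def)
qed

text \<open>\<open>H\<close> is \<open>gens\<close>. It lies in any generating set \<open>G\<close>
  because a member of \<open>gens\<close> is a multiple of some g in \<open>G\<close> and must
  therefore equal g.\<close>

lemma lex_ideal_numerator:
  fixes L :: "'k::field mpol set"
  assumes lex: "lex_ideal n L" and gen: "generated_by_monomials n L G" and "finite G"
    and zero: "hilbert_function L 0 = 0"
  obtains H where "H \<subseteq> G" "\<And>u. u \<in> H \<Longrightarrow> 1 \<le> max_var u \<and> max_var u \<le> n"
    "hilbert_series L * (1 - fps_X) ^ n = (\<Sum>u\<in>H. fps_X ^ mdeg u * (1 - fps_X) ^ (max_var u - 1))"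
proof -
  let ?A = "ideal_monomials n G"
  have L: "L = {p. Poly_Mapping.keys p \<subseteq> ?A}"
    by (rule generated_by_monomials_eq[OF gen])
  have "is_ideal n L"
    unfolding L by (rule is_ideal_ideal_monomials)
  then have hf: "hilbert_function L k = card {u \<in> ?A. mdeg u = k}" for k
    using L by (intro hilbert_function_generated_by_monomials) (auto simp: ideal_monomials_def)
  have "0 \<notin> ?A"
  proof
    assume "0 \<in> ?A"
    then have "{u \<in> ?A. mdeg u = 0} = {0}" by auto
    then show False using zero hf[of 0] by simp
  qed
  then interpret stable_set n ?A
    by (rule lex_ideal_stable[OF lex L])
  have "gens \<subseteq> G"
  proof
    fix u assume u: "u \<in> gens"
    then have uA: "u \<in> ?A" by (simp only: gens_def mem_Collect_eq)
    then obtain g v where gv: "g \<in> G" "u = g + v"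
      unfolding ideal_monomials_def by blast
    have "g \<in> monomials n" using gv(1) gen by (auto simp: generated_by_monomials_def)
    moreover have "g = g + 0" by simp
    ultimately have "g \<in> ?A" using gv(1) unfolding ideal_monomials_def by blast
    moreover have "v \<in> monomials n"
      using uA gv(2) by (simp add: ideal_monomials_def keys_add_nat)
    ultimately have "v = 0" using multiple_in_gens u gv(2) by blast
    then show "u \<in> G" using gv by simp
  qed
  moreover have "hilbert_series L = Abs_fps (\<lambda>k. int (card {u \<in> ?A. mdeg u = k}))"
    by (simp add: hilbert_series_def hf)
  ultimately show ?thesis
    using that[of gens] max_var_gens series_of_degrees finite_subset[OF _ \<open>finite G\<close>] by simp
qed

theorem mainTheorem6:
  fixes n :: nat
    and I L :: "'k::field mpol set"
    and us :: "monom list"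
    and m d r :: nat
    and c :: "nat \<Rightarrow> int"
    and Q :: "int poly"
  assumes "graded_ideal n I"
    and "I \<noteq> {0}"
    and "I \<noteq> poly_ring n"
    and "lex_ideal n L"
    and "\<forall>k. hilbert_function L k = hilbert_function I k"
    and "minimal_monomial_generators n L (set us)"
    and "m = Max ((\<lambda>u. max_var u + mdeg u - 1) ` set us)"
    and "d \<le> r"
    and "c d \<noteq> 0"
    and "c r \<noteq> 0"
    and "hilbert_series I * (1 - fps_X) ^ n = (\<Sum>i=d..r. fps_const (c i) * fps_X ^ i)"
    and "Q = (\<Sum>i=d..m. monom (if i \<le> r then c i else 0) i)"
  shows "r \<le> m \<and>
    (\<exists>q\<le>m - d. final_q Q d m = Some q) \<and>
    hdepth_procedure n Q d m = Some (int (hdepth n I))"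
proof -
  have I: "is_ideal n I" using assms(1) by (simp add: graded_ideal_def)
  have zero: "hilbert_function L 0 = 0"
    using ideal_eq_poly_ring_if_hilbert_function_0[OF I] assms(3) unfolding assms(5)[rule_format] by blast
  have LI: "hilbert_series L = hilbert_series I"
    using assms(5) by (simp add: hilbert_series_def)
  have "generated_by_monomials n L (set us)"
    using assms(6) by (simp add: minimal_monomial_generators_def)
  then obtain H where H: "H \<subseteq> set us" "\<And>u. u \<in> H \<Longrightarrow> 1 \<le> max_var u \<and> max_var u \<le> n"
      "hilbert_series I * (1 - fps_X) ^ n = (\<Sum>u\<in>H. fps_X ^ mdeg u * (1 - fps_X) ^ (max_var u - 1))"
    using lex_ideal_numerator[OF assms(4) _ finite_set zero] unfolding LI by blast
  define F where "F = hilbert_series I * (1 - fps_X) ^ n"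
  \<comment> \<open>So m bounds the degree of every summand of the numerator, which gives r \<le> m
    below.\<close>
  have H_le: "mdeg u + (max_var u - 1) \<le> m" if "u \<in> H" for u
  proof -
    have "max_var u + mdeg u - 1 \<le> m"
      unfolding assms(7) using that H(1) by (intro Max_ge) auto
    then show ?thesis using H(2)[OF that] by simp
  qed
  have F_nth: "fps_nth F i = (if d \<le> i \<and> i \<le> r then c i else 0)" for i
    by (simp add: F_def assms(11) fps_sum_nth if_distrib cong: if_cong)
  have F_above: "fps_nth F i = 0" if "i > m" for i
  proof -
    have "fps_nth (fps_X ^ mdeg u * (1 - fps_X :: int fps) ^ (max_var u - 1)) i = 0" if "u \<in> H" for u
      using H_le[OF that] \<open>i > m\<close> by (simp add: fps_X_power_mult_nth fps_nth_one_minus_X_power_eq_0)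
    then show ?thesis by (simp add: F_def H(3) fps_sum_nth)
  qed
  have rm: "r \<le> m"
    using F_above[of r] F_nth[of r] assms(8,10) by (cases "r \<le> m") auto
  then have dm: "d \<le> m" using assms(8) by simp
  have Q_coeff: "coeff Q i = fps_nth F i" for i
  proof -
    have "coeff Q i = (\<Sum>j = d..m. if j = i then (if j \<le> r then c j else 0) else 0)"
      unfolding assms(12) coeff_sum coeff_monom ..
    then show ?thesis using rm by (simp add: F_nth)
  qed
  have QF: "fps_of_poly Q = F"
    by (rule fps_ext) (simp add: Q_coeff)
  have Q_below: "coeff Q i = 0" if "i < d" for i using that by (simp add: Q_coeff F_nth)
  have Q_above: "coeff Q i = 0" if "i > m" for i using that by (simp add: Q_coeff F_above)
  have QH: "fps_of_poly Q = (\<Sum>u\<in>H. fps_X ^ mdeg u * (1 - fps_X) ^ (max_var u - 1))"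
    by (simp add: QF F_def H(3))
  have series: "hilbert_series I = F * geom ^ n"
    by (simp add: F_def mult.assoc)

  define good where "good = (\<lambda>q. \<forall>i\<in>{d..m}. b_coeff Q d m q i \<ge> 0)"
  have goodI: "good q" if "\<And>i. d \<le> i \<Longrightarrow> i + q \<le> m \<Longrightarrow> fps_nth (F * geom ^ q) i \<ge> 0" for q
    unfolding good_def
  proof
    fix i assume "i \<in> {d..m}"
    then show "b_coeff Q d m q i \<ge> 0"
      using that[of i] by (intro b_coeff_nonneg[OF QH H_le Q_below]) (auto simp: QF)
  qed
  \<comment> \<open>\<open>F\<close> starts in degree d and powers of \<open>geom\<close> have
    constant term 1. For k = n this coefficient is a value of the Hilbert function, hence
    \<open>c d\<close> is nonnegative.\<close>
  have F_low: "fps_nth (F * geom ^ k) d = c d" for k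
    using assms(8) by (subst fps_mult_nth_lowest) (auto simp: F_nth)
  have c_pos: "c d \<ge> 0"
    using F_low[of n] by (simp add: hilbert_series_def flip: series)
  \<comment> \<open>For q = m - d the only index left to test is i = d.\<close>
  have good_md: "good (m - d)"
  proof (rule goodI)
    fix i assume "d \<le> i" "i + (m - d) \<le> m"
    then have "i = d" using dm by simp
    then show "fps_nth (F * geom ^ (m - d)) i \<ge> 0" using F_low c_pos by simp
  qed
  have "H \<noteq> {}"
    using F_nth[of d] assms(8,9) H(3) by (auto simp: F_def)
  then have n: "n \<ge> 1" using H(2) by fastforce
  \<comment> \<open>Every exponent max_var u - 1 is at most n - 1, so all summands become
    nonnegative. This yields q < n, which makes \<open>n - q\<close> a true difference.\<close>
  have good_n: "good (n - 1)"
  proof (rule goodI)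
    fix i
    have "nonneg_fps (fps_X ^ mdeg u * (1 - fps_X) ^ (max_var u - 1) * geom ^ (n - 1))" if "u \<in> H" for u
    proof -
      have "max_var u - 1 \<le> n - 1" using H(2)[OF that] by (intro diff_le_mono) simp
      then show ?thesis
        unfolding mult.assoc
        by (simp only: geom_power_cancel nonneg_fps_mult[OF nonneg_fps_X_power nonneg_fps_geom_power])
    qed
    then have "nonneg_fps (F * geom ^ (n - 1))"
      unfolding F_def H(3) sum_distrib_right by (rule nonneg_fps_sum)
    then show "fps_nth (F * geom ^ (n - 1)) i \<ge> 0" by (simp add: nonneg_fps_def)
  qed
  define q where "q = (LEAST q. good q)"
  have q_le: "q \<le> q'" if "good q'" for q'
    unfolding q_def using that by (rule Least_le)
  have q: "good q" "q \<le> m - d" "q < n"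
    using LeastI[of good, OF good_md] q_le[OF good_md] q_le[OF good_n] n by (simp_all add: q_def)
  have final: "final_q Q d m = Some q"
    using final_q_eq_Least[of d m Q "m - d"] good_md by (simp add: q_def good_def)

  have depth_le: "decomposition_depth D \<le> n - q" if "hilbert_decomposition n I D \<phi>" for D \<phi>
  proof -
    let ?p = "decomposition_depth D"
    have D_series: "hilbert_series I = decomposition_series D"
      by (rule hilbert_series_if_decomposition[OF I that])
    have "F \<noteq> 0" using F_nth[of d] assms(8,9) by auto
    then have "D \<noteq> []" using D_series by (auto simp: F_def decomposition_series_def)
    then have pn: "?p \<le> n"
      using that by (intro decomposition_depth_le) (auto simp: hilbert_decomposition_def)
    have "?p \<le> card Z" if "(Z, s) \<in> set D" for Z s
      unfolding decomposition_depth_def using that by (intro Min_le) force+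
    then have "nonneg_fps (hilbert_series I * (1 - fps_X) ^ ?p)"
      unfolding D_series by (rule nonneg_fps_decomposition_series)
    moreover have "F * geom ^ (n - ?p) = hilbert_series I * (1 - fps_X) ^ ?p"
      using one_minus_X_power_cancel[of "n - ?p" n] pn by (simp add: F_def mult.assoc)
    \<comment> \<open>A decomposition of depth \<open>?p\<close> makes F/(1 - t)^(n - ?p)
      nonnegative, so n - ?p passes the test and is at least the minimal \<open>q\<close>.\<close>
    ultimately have "good (n - ?p)"
      by (intro goodI) (simp add: nonneg_fps_def)
    then show ?thesis using q_le pn by fastforce
  qed
  have F_sum: "F = (\<Sum>i = d..m. fps_const (b_coeff Q d m q i) * (fps_X ^ i * (1 - fps_X) ^ min q (m - i)))"
    using fps_of_poly_eq_b_coeff_sum[of d Q m q, OF Q_below Q_above dm] unfolding QF .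
  have "\<exists>D. (\<forall>(Z, s)\<in>set D. Z \<subseteq> {1..n} \<and> (\<exists>i. card Z = n - min q (m - i))) \<and>
      decomposition_series D = F * geom ^ n"
    unfolding F_sum
  proof (rule exists_decomposition_series)
    show "b_coeff Q d m q i \<ge> 0" if "d \<le> i" "i \<le> m" for i
      using q(1) that by (simp add: good_def)
    show "min q (m - i) \<le> n" for i using q(3) by simp
  qed
  then obtain D where D: "\<forall>(Z, s)\<in>set D. Z \<subseteq> {1..n} \<and> (\<exists>i. card Z = n - min q (m - i))"
      "decomposition_series D = F * geom ^ n"
    by blast
  have "\<exists>\<phi>. hilbert_decomposition n I D \<phi>"
  proof (rule decomposition_if_hilbert_series[OF assms(1)])
    show "Z \<subseteq> {1..n}" if "(Z, s) \<in> set D" for Z s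
      using bspec[OF D(1) that] by simp
  qed (simp only: series D(2))
  then obtain \<phi> where \<phi>: "hilbert_decomposition n I D \<phi>" ..
  \<comment> \<open>Its coefficient at d is c d. Thus \<open>D\<close> is nonempty and the
    \<open>Min\<close> in its depth is taken over a nonempty set.\<close>
  have "decomposition_series D \<noteq> 0"
    using F_low[of n] assms(9) unfolding D(2) by (metis fps_zero_nth)
  then have "D \<noteq> []" by (auto simp: decomposition_series_def)
  have "n - q \<le> card Z" if "(Z, s) \<in> set D" for Z s
    using bspec[OF D(1) that] by auto
  then have "decomposition_depth D \<ge> n - q"
    unfolding decomposition_depth_def using \<open>D \<noteq> []\<close> by (intro Min.boundedI) auto
  then have depth: "decomposition_depth D = n - q" using depth_le[OF \<phi>] by (rule antisym[rotated])
  have "hdepth n I = n - q"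
    unfolding hdepth_def
  proof (rule Max_eqI)
    \<comment> \<open>The bound on the depths makes their set finite, so that \<open>Max\<close> is
      a true maximum.\<close>
    have "{decomposition_depth D |D \<phi>. hilbert_decomposition n I D \<phi>} \<subseteq> {..n - q}"
      using depth_le by blast
    then show "finite {decomposition_depth D |D \<phi>. hilbert_decomposition n I D \<phi>}"
      by (rule finite_subset) simp
    show "n - q \<in> {decomposition_depth D |D \<phi>. hilbert_decomposition n I D \<phi>}"
      unfolding depth[symmetric] using \<phi> by blast
  qed (use depth_le in blast)
  then show ?thesis
    using rm final q by (simp add: hdepth_procedure_def of_nat_diff)
qed

end
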